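(* Let $\phi:K\to M\subset\mathbb{R}^D$ be an admissible triangulation, with $K$ purely $d$-dimensional. Then there is $r_0>0$ such that for all distinct $d$-simplices $\sigma_1\ne\sigma_2$ of $K$ and all points $x_1\in\phi(\sigma_1)$, $x_2\in\phi(\sigma_2)$ with $\|x_1-x_2\|\le r_0$, the following holds for $i=1,2$: $$\mathsf{d}_E(x_i,\partial_\phi M)\le\frac{2\|x_1-x_2\|}{\sin(\Theta_\phi/4)}.$$
   Context: $\mathsf{d}_E$ is the Euclidean distance in $\mathbb{R}^D$ (from a point to a set). A triangulation $\phi:K\to M$ is a homeomorphism from a finite geometric simplicial complex $K$ to $M\subset\mathbb{R}^D$; it is $C^2$ if on each closed simplex it extends to a $C^2$ map on an open neighbourhood, and its restriction to each simplex is a $C^2$ embedding (injective differential). $K$ is purely $d$-dimensional if all maximal simplices are $d$-dimensional. For a simplex $\sigma\in K$ put $\tilde\sigma=\phi(\sigma)$. For $x=\phi(t)\in\partial\tilde\sigma$ let $\tilde\sigma_x$ be the image of the smallest face of $\sigma$ containing $t$. The inward cone is $\mathfrak{I}_x\tilde\sigma=\{D_t(\phi|_\sigma)(w): t+\epsilon w\in\sigma\text{ for some }\epsilon>0\}$, and the normal inward cone $\mathfrak{N}_x\tilde\sigma$ is the set of $v\in\mathfrak{I}_x\tilde\sigma$ perpendicular to $T_x\tilde\sigma_x$. The strata separation angle is $$\Theta_\phi=\inf_{\sigma_1,\sigma_2,p}d_{\mathbb S}\big(\mathfrak{N}_{\phi(p)}\tilde\sigma_1,\mathfrak{N}_{\phi(p)}\tilde\sigma_2\big),$$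 over distinct intersecting $d$-simplices $\sigma_1\ne\sigma_2$ of $K$ and points $p$ in the relative interior of $\sigma_1\cap\sigma_2$ (with $\Theta_\phi=\pi$ if there are none); $d_{\mathbb S}(A_1,A_2)$ is the spherical distance between $A_1\cap\mathbb{S}^{D-1}$ and $A_2\cap\mathbb{S}^{D-1}$. A $C^2$ triangulation $\phi:K\to M\subset\mathbb{R}^D$ is admissible if $M$ is compact, $K$ is purely $d$-dimensional and $\Theta_\phi>0$. The $\phi$-skeleton of $M$ is $\partial_\phi M=M\setminus\bigcup_\sigma\phi(\sigma^\circ)$, the union over maximal simplices $\sigma\in K$, where $\sigma^\circ$ is the interior of $\sigma$. *)

theory Defs
  imports "HOL-Analysis.Analysis"
begin

text \<open>
  The complex is the library's \<^const>\<open>simplicial_complex\<close>: a finite set of closed geometric simplices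
  (which also contains the empty face). It is purely \<open>d\<close>-dimensional if all inclusion-maximal
  members are \<open>d\<close>-simplices.
\<close>

definition maximal_simplices :: "'a::euclidean_space set set \<Rightarrow> 'a set set" where
  "maximal_simplices K = {\<sigma> \<in> K. \<forall>\<tau>\<in>K. \<sigma> \<subseteq> \<tau> \<longrightarrow> \<tau> = \<sigma>}"

definition purely_dimensional :: "nat \<Rightarrow> 'a::euclidean_space set set \<Rightarrow> bool" where
  "purely_dimensional d K \<longleftrightarrow> (\<forall>\<sigma> \<in> maximal_simplices K. int d simplex \<sigma>)"

definition C2_on :: "'a::euclidean_space set \<Rightarrow> ('a \<Rightarrow> 'b::euclidean_space) \<Rightarrow> bool" where
  "C2_on U g \<longleftrightarrow>
     (\<exists>(g' :: 'a \<Rightarrow> 'a \<Rightarrow>\<^sub>L 'b) (g'' :: 'a \<Rightarrow> 'a \<Rightarrow>\<^sub>L ('a \<Rightarrow>\<^sub>L 'b)).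
        (\<forall>x\<in>U. (g has_derivative blinfun_apply (g' x)) (at x) \<and>
               (g' has_derivative blinfun_apply (g'' x)) (at x)) \<and>
        continuous_on U g'')"

definition dir_space :: "'a::euclidean_space set \<Rightarrow> 'a set" where
  "dir_space F = span {b - a | a b. a \<in> F \<and> b \<in> F}"

text \<open>
  The differential of the restriction of \<open>\<phi>\<close> to \<open>\<sigma>\<close> at \<open>t \<in> \<sigma>\<close>. If \<open>\<sigma>\<close> is not full-dimensional in
  the ambient space, a derivative within \<open>\<sigma>\<close> is determined only on \<open>dir_space \<sigma>\<close>; all uses below
  apply it to vectors of that subspace only.
\<close>

definition simplex_deriv ::
    "('a::euclidean_space \<Rightarrow> 'b::euclidean_space) \<Rightarrow> 'a set \<Rightarrow> 'a \<Rightarrow> 'a \<Rightarrow> 'b" where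
  "simplex_deriv \<phi> \<sigma> t = frechet_derivative \<phi> (at t within \<sigma>)"

definition C2_triangulation ::
    "'a::euclidean_space set set \<Rightarrow> ('a \<Rightarrow> 'b::euclidean_space) \<Rightarrow> 'b set \<Rightarrow> bool" where
  "C2_triangulation K \<phi> M \<longleftrightarrow>
     simplicial_complex K \<and>
     (\<exists>\<psi>. homeomorphism (\<Union>K) M \<phi> \<psi>) \<and>
     (\<forall>\<sigma>\<in>K.
        (\<exists>U g. open U \<and> \<sigma> \<subseteq> U \<and> C2_on U g \<and> (\<forall>t\<in>\<sigma>. g t = \<phi> t)) \<and>
        (\<forall>t\<in>\<sigma>. inj_on (simplex_deriv \<phi> \<sigma> t) (dir_space \<sigma>)))"

definition smallest_face :: "'a::euclidean_space set \<Rightarrow> 'a \<Rightarrow> 'a set" where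
  "smallest_face \<sigma> t = \<Inter>{F. F face_of \<sigma> \<and> t \<in> F}"

text \<open>The cones at \<open>x = \<phi> t\<close> are indexed by the parameter \<open>t\<close>.\<close>

definition inward_cone ::
    "('a::euclidean_space \<Rightarrow> 'b::euclidean_space) \<Rightarrow> 'a set \<Rightarrow> 'a \<Rightarrow> 'b set" where
  "inward_cone \<phi> \<sigma> t = {simplex_deriv \<phi> \<sigma> t w | w. \<exists>\<epsilon>>0. t + \<epsilon> *\<^sub>R w \<in> \<sigma>}"

definition face_tangent_space ::
    "('a::euclidean_space \<Rightarrow> 'b::euclidean_space) \<Rightarrow> 'a set \<Rightarrow> 'a \<Rightarrow> 'b set" where
  "face_tangent_space \<phi> \<sigma> t = simplex_deriv \<phi> \<sigma> t ` dir_space (smallest_face \<sigma> t)"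

definition normal_inward_cone ::
    "('a::euclidean_space \<Rightarrow> 'b::euclidean_space) \<Rightarrow> 'a set \<Rightarrow> 'a \<Rightarrow> 'b set" where
  "normal_inward_cone \<phi> \<sigma> t =
     {v \<in> inward_cone \<phi> \<sigma> t. \<forall>u \<in> face_tangent_space \<phi> \<sigma> t. orthogonal v u}"

text \<open>
  The value \<open>pi\<close> for sets without unit vectors is a mere convention: the normal inward cones in
  \<open>strata_separation_angle\<close> below always contain unit vectors, because \<open>\<sigma>\<^sub>1 \<inter> \<sigma>\<^sub>2\<close> is a proper face
  of both simplices.
\<close>

definition spherical_setdist :: "'b::euclidean_space set \<Rightarrow> 'b set \<Rightarrow> real" where
  "spherical_setdist A B =
     (if A \<inter> sphere 0 1 = {} \<or> B \<inter> sphere 0 1 = {} then pi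
      else Inf {arccos (u \<bullet> v) | u v. u \<in> A \<inter> sphere 0 1 \<and> v \<in> B \<inter> sphere 0 1})"

definition strata_separation_angle ::
    "nat \<Rightarrow> 'a::euclidean_space set set \<Rightarrow> ('a \<Rightarrow> 'b::euclidean_space) \<Rightarrow> real" where
  "strata_separation_angle d K \<phi> =
     (let A = {spherical_setdist (normal_inward_cone \<phi> \<sigma>\<^sub>1 p) (normal_inward_cone \<phi> \<sigma>\<^sub>2 p) | \<sigma>\<^sub>1 \<sigma>\<^sub>2 p.
                 \<sigma>\<^sub>1 \<in> K \<and> \<sigma>\<^sub>2 \<in> K \<and> int d simplex \<sigma>\<^sub>1 \<and> int d simplex \<sigma>\<^sub>2 \<and>
                 \<sigma>\<^sub>1 \<noteq> \<sigma>\<^sub>2 \<and> \<sigma>\<^sub>1 \<inter> \<sigma>\<^sub>2 \<noteq> {} \<and> p \<in> rel_interior (\<sigma>\<^sub>1 \<inter> \<sigma>\<^sub>2)}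
      in if A = {} then pi else Inf A)"

definition admissible_triangulation ::
    "nat \<Rightarrow> 'a::euclidean_space set set \<Rightarrow> ('a \<Rightarrow> 'b::euclidean_space) \<Rightarrow> 'b set \<Rightarrow> bool" where
  "admissible_triangulation d K \<phi> M \<longleftrightarrow>
     C2_triangulation K \<phi> M \<and> compact M \<and> purely_dimensional d K \<and>
     strata_separation_angle d K \<phi> > 0"

definition skeleton ::
    "'a::euclidean_space set set \<Rightarrow> ('a \<Rightarrow> 'b::euclidean_space) \<Rightarrow> 'b set \<Rightarrow> 'b set" where
  "skeleton K \<phi> M = M - (\<Union>\<sigma> \<in> maximal_simplices K. \<phi> ` rel_interior \<sigma>)"

end

theory Submission
  imports Defs
begin

text \<open>
  Suppose first that all simplices are flat and embedded linearly. Let \<open>F = \<sigma>\<^sub>1 \<inter> \<sigma>\<^sub>2\<close> and project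
  \<open>x\<^sub>1\<close> and \<open>x\<^sub>2\<close> orthogonally along the direction space of \<open>F\<close>. The projections of \<open>x\<^sub>i - p\<close>, for \<open>p\<close> in the
  relative interior of \<open>F\<close>, lie in the normal inward cones of the two simplices at \<open>p\<close>. These cones are
  separated by the angle \<open>\<Theta>\<close>, so the distance from \<open>x\<^sub>1\<close> to the affine hull of \<open>F\<close> is at most
  \<open>norm (x\<^sub>1 - x\<^sub>2) / sin (\<Theta> / 4)\<close> (lemmas \<open>norm_diff_ge_of_spherical_setdist\<close> and
  \<open>tangent_distance_to_common_face\<close>). Since that affine hull does not meet the relative interior of
  \<open>\<sigma>\<^sub>1\<close>, the segment from \<open>x\<^sub>1\<close> to the nearest point of the hull meets the boundary of \<open>\<sigma>\<^sub>1\<close>, which is part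
  of the skeleton. Hence the skeleton is at least as close to \<open>x\<^sub>1\<close>.

  In general \<open>\<phi>\<close> is replaced by its differentials at a base point \<open>p\<close>, and the factor \<open>2\<close> in the
  statement leaves room for the error. Making the error small against \<open>norm (x\<^sub>1 - x\<^sub>2)\<close>, which may be far
  smaller than the distance from \<open>x\<^sub>1\<close> to a given point of the common face, requires a base point
  adapted to \<open>x\<^sub>1\<close>. The limit points of such base points may lie on the boundary of \<open>F\<close>, where the
  separation angle says nothing about these two simplices. No limit is therefore taken: each pair of
  points gets its own base point in the relative interior of \<open>F\<close>, and the differentials are controlled
  uniformly over the compact simplices (lemma \<open>simplex_deriv_bounds\<close>). That the base point can be chosen
  close enough to \<open>x\<^sub>1\<close> is a property of simplices (lemma \<open>face_regularity\<close>): in the parameter domain, the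
  distance to a face is at most a constant times the distance to its affine hull. Pairs of points in
  disjoint simplices, or far from the common face, are excluded by taking \<open>r\<^sub>0\<close> small
  (lemma \<open>near_pairs_near_common_points\<close>).
\<close>

section \<open>Derivatives along a simplex\<close>

text \<open>
  A lower-dimensional simplex does not determine a derivative within it on all of the ambient
  space, so \<open>frechet_derivative\<close> returns an arbitrary one. The values on \<open>dir_space S\<close> are forced,
  however: along the segment from \<open>t\<close> to any \<open>s \<in> S\<close> the derivative is an ordinary one-sided derivative
  in one variable, and the differences \<open>s - t\<close> span \<open>dir_space S\<close>. This is used twice: to identify
  \<open>simplex_deriv\<close> with the derivative of a smooth extension, and to see that the
  differentials on two simplices agree along their common face.
\<close>

lemma has_derivative_within_eq_on_dir_space:
  fixes f :: "'a::euclidean_space \<Rightarrow> 'b::euclidean_space"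
  assumes "convex S" "t \<in> S"
    and f1: "(f has_derivative f1) (at t within S)"
    and f2: "(f has_derivative f2) (at t within S)"
    and w: "w \<in> dir_space S"
  shows "f1 w = f2 w"
proof -
  have lin: "linear f1" "linear f2"
    using f1 f2 has_derivative_linear by blast+
  have edge: "f1 (s - t) = f2 (s - t)" if s: "s \<in> S" for s
  proof -
    let ?g = "\<lambda>r::real. t + r *\<^sub>R (s - t)"
    have sub: "?g ` cbox 0 1 \<subseteq> S"
    proof clarify
      fix r :: real assume "r \<in> cbox 0 1"
      then have "(1 - r) *\<^sub>R t + r *\<^sub>R s \<in> S"
        using \<open>convex S\<close> \<open>t \<in> S\<close> s by (auto simp: convex_alt)
      then show "t + r *\<^sub>R (s - t) \<in> S"
        by (simp add: algebra_simps)
    qed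
    have g: "(?g has_vector_derivative (s - t)) (at 0 within cbox 0 1)"
      by (auto intro!: derivative_eq_intros simp: has_vector_derivative_def)
    have "((f \<circ> ?g) has_vector_derivative f' (s - t)) (at 0 within cbox 0 1)"
      if "(f has_derivative f') (at t within S)" for f'
    proof (rule vector_derivative_diff_chain_within[OF g])
      show "(f has_derivative f') (at (?g 0) within ?g ` cbox 0 1)"
        using has_derivative_subset[OF that sub] by simp
    qed
    then show ?thesis
      using f1 f2 by (intro vector_derivative_unique_within_closed_interval[of 0 1 0]) auto
  qed
  have "b - a \<in> {v. f1 v = f2 v}" if "a \<in> S" "b \<in> S" for a b
  proof -
    have "f1 ((b - t) - (a - t)) = f2 ((b - t) - (a - t))"
      using edge that lin by (simp only: linear_diff)
    then show ?thesis by simp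
  qed
  then have "{b - a | a b. a \<in> S \<and> b \<in> S} \<subseteq> {v. f1 v = f2 v}" by blast
  moreover have "subspace {v. f1 v = f2 v}"
    using lin by (auto simp: subspace_def linear_0 linear_add linear_scale)
  ultimately have "dir_space S \<subseteq> {v. f1 v = f2 v}"
    unfolding dir_space_def by (rule span_minimal)
  then show ?thesis using w by blast
qed

text \<open>
  The mean value inequality for \<open>g - g' p\<close> on \<open>S \<inter> ball p \<delta>\<close>, with \<open>\<delta>\<close> from the uniform continuity
  of \<open>g'\<close>. Two points \<open>s\<close>, \<open>s'\<close> and a third base point \<open>p\<close> are needed because a point of the simplex is
  compared with a boundary point through the differential at a point of the common face.
\<close>

lemma uniform_linearization:
  fixes g :: "'a::euclidean_space \<Rightarrow> 'b::euclidean_space"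
    and g' :: "'a \<Rightarrow> 'a \<Rightarrow>\<^sub>L 'b"
  assumes "compact S" "convex S" "continuous_on S g'"
    and der: "\<And>x. x \<in> S \<Longrightarrow> (g has_derivative blinfun_apply (g' x)) (at x within S)"
    and "\<eta> > 0"
  shows "\<exists>\<delta>>0. \<forall>s\<in>S. \<forall>s'\<in>S. \<forall>p\<in>S. dist s p < \<delta> \<longrightarrow> dist s' p < \<delta> \<longrightarrow>
           norm (g s - g s' - g' p (s - s')) \<le> \<eta> * norm (s - s')"
proof -
  have "uniformly_continuous_on S g'"
    using assms by (intro compact_uniformly_continuous)
  then obtain \<delta> where "\<delta> > 0" and \<delta>: "\<And>x p. \<lbrakk>x \<in> S; p \<in> S; dist x p < \<delta>\<rbrakk> \<Longrightarrow> dist (g' x) (g' p) < \<eta>"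
    using \<open>\<eta> > 0\<close> unfolding uniformly_continuous_on_def by (metis dist_commute)
  have "norm (g s - g s' - g' p (s - s')) \<le> \<eta> * norm (s - s')"
    if "s \<in> S" "s' \<in> S" "p \<in> S" "dist s p < \<delta>" "dist s' p < \<delta>" for s s' p
  proof -
    let ?B = "S \<inter> ball p \<delta>"
    have "norm ((g s - g' p s) - (g s' - g' p s')) \<le> \<eta> * norm (s - s')"
    proof (rule differentiable_bound[where S = ?B and f' = "\<lambda>x. blinfun_apply (g' x - g' p)"])
      show "convex ?B" using \<open>convex S\<close> by (simp add: convex_Int)
      show "s \<in> ?B" "s' \<in> ?B" using that by (auto simp: dist_commute)
      fix x assume x: "x \<in> ?B"
      have "(g has_derivative blinfun_apply (g' x)) (at x within ?B)"
        using der x by (blast intro: has_derivative_subset)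
      then show "((\<lambda>x. g x - g' p x) has_derivative blinfun_apply (g' x - g' p)) (at x within ?B)"
        by (auto intro!: derivative_eq_intros simp: blinfun.diff_left)
      show "onorm (blinfun_apply (g' x - g' p)) \<le> \<eta>"
        using \<delta>[of x p] x \<open>p \<in> S\<close>
        by (simp add: norm_blinfun.rep_eq[symmetric] dist_norm norm_minus_commute less_imp_le)
    qed
    then show ?thesis by (simp add: blinfun.diff_right algebra_simps)
  qed
  with \<open>\<delta> > 0\<close> show ?thesis by blast
qed

text \<open>
  The function \<open>norm (g' p w)\<close> is continuous and positive on the compact set of pairs of a point of
  \<open>S\<close> and a unit vector of \<open>V\<close>.
\<close>

lemma uniform_bounds_on_subspace:
  fixes g' :: "'a::euclidean_space \<Rightarrow> 'a \<Rightarrow>\<^sub>L 'b::euclidean_space"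
  assumes "compact S" "continuous_on S g'" "subspace V"
    and inj: "\<And>x. x \<in> S \<Longrightarrow> inj_on (blinfun_apply (g' x)) V"
  shows "\<exists>m>0. \<exists>\<Lambda>. \<forall>p\<in>S. \<forall>w\<in>V. m * norm w \<le> norm (g' p w) \<and> norm (g' p w) \<le> \<Lambda> * norm w"
proof -
  let ?N = "S \<times> (V \<inter> sphere 0 1)"
  have "compact (V \<inter> sphere 0 1)"
    using \<open>subspace V\<close> by (intro closed_Int_compact closed_subspace) auto
  then have comp: "compact ?N" using \<open>compact S\<close> by (rule compact_Times[rotated])
  have cont: "continuous_on ?N (\<lambda>x. norm (g' (fst x) (snd x)))"
    by (intro continuous_intros continuous_on_compose2[OF \<open>continuous_on S g'\<close>]) auto
  have scale: "norm (g' p w) = norm w * norm (g' p (w /\<^sub>R norm w))" if "w \<noteq> 0" for p w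
    using that by (simp add: blinfun.scaleR_right)
  show ?thesis
  proof (cases "?N = {}")
    case True
    have "w = 0" if "p \<in> S" "w \<in> V" for p w
    proof (rule ccontr)
      assume "w \<noteq> 0"
      then have "(p, w /\<^sub>R norm w) \<in> ?N"
        using that \<open>subspace V\<close> by (auto simp: subspace_scale)
      with True show False by blast
    qed
    then have "\<forall>p\<in>S. \<forall>w\<in>V. 1 * norm w \<le> norm (g' p w) \<and> norm (g' p w) \<le> 0 * norm w"
      by (metis blinfun.zero_right mult_1 mult_zero_left norm_zero order_refl)
    then show ?thesis using zero_less_one by blast
  next
    case False
    obtain z where z: "z \<in> ?N" "\<And>y. y \<in> ?N \<Longrightarrow> norm (g' (fst z) (snd z)) \<le> norm (g' (fst y) (snd y))"
      using continuous_attains_inf[OF comp False cont] by blast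
    obtain Z where Z: "\<And>y. y \<in> ?N \<Longrightarrow> norm (g' (fst y) (snd y)) \<le> norm (g' (fst Z) (snd Z))"
      using continuous_attains_sup[OF comp False cont] by blast
    let ?m = "norm (g' (fst z) (snd z))" and ?L = "norm (g' (fst Z) (snd Z))"
    have "fst z \<in> S" "snd z \<in> V" "snd z \<noteq> 0"
      using z(1) by auto
    then have "g' (fst z) (snd z) \<noteq> g' (fst z) 0"
      using inj[of "fst z"] subspace_0[OF \<open>subspace V\<close>] by (metis inj_onD)
    then have "?m > 0" by (simp add: blinfun.zero_right)
    moreover have "?m * norm w \<le> norm (g' p w) \<and> norm (g' p w) \<le> ?L * norm w"
      if "p \<in> S" "w \<in> V" for p w
    proof (cases "w = 0")
      case False
      then have "(p, w /\<^sub>R norm w) \<in> ?N"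
        using that \<open>subspace V\<close> by (auto simp: subspace_scale)
      then show ?thesis
        using z(2)[of "(p, w /\<^sub>R norm w)"] Z[of "(p, w /\<^sub>R norm w)"] scale[OF False, of p]
        by (simp add: mult.commute mult_left_mono del: norm_scaleR)
    qed (simp add: blinfun.zero_right)
    ultimately show ?thesis by blast
  qed
qed

lemma subspace_dir_space [simp]: "subspace (dir_space S)"
  by (simp add: dir_space_def)

lemma dir_space_mono: "S \<subseteq> T \<Longrightarrow> dir_space S \<subseteq> dir_space T"
  unfolding dir_space_def by (intro span_mono) blast

lemma diff_in_dir_space: "a \<in> S \<Longrightarrow> b \<in> S \<Longrightarrow> b - a \<in> dir_space S"
  unfolding dir_space_def by (intro span_base) blast

lemma C2_on_simplex_derivative:
  fixes \<phi> :: "'a::euclidean_space \<Rightarrow> 'b::euclidean_space"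
  assumes "C2_triangulation K \<phi> M" "\<sigma> \<in> K"
  obtains g' :: "'a \<Rightarrow> 'a \<Rightarrow>\<^sub>L 'b"
  where "continuous_on \<sigma> g'"
    and "\<And>t. t \<in> \<sigma> \<Longrightarrow> (\<phi> has_derivative blinfun_apply (g' t)) (at t within \<sigma>)"
proof -
  obtain U g where U: "open U" "\<sigma> \<subseteq> U" "C2_on U g" "\<And>t. t \<in> \<sigma> \<Longrightarrow> g t = \<phi> t"
    using assms unfolding C2_triangulation_def by metis
  obtain g' :: "'a \<Rightarrow> 'a \<Rightarrow>\<^sub>L 'b" and g''
    where g: "\<And>x. x \<in> U \<Longrightarrow> (g has_derivative blinfun_apply (g' x)) (at x)"
      "\<And>x. x \<in> U \<Longrightarrow> (g' has_derivative blinfun_apply (g'' x)) (at x)"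
    using U(3) unfolding C2_on_def by metis
  show ?thesis
  proof (rule that[of g'])
    show "continuous_on \<sigma> g'"
      using g(2) U(2) has_derivative_continuous
      by (meson continuous_at_imp_continuous_on subset_iff)
    fix t assume t: "t \<in> \<sigma>"
    then have "(g has_derivative blinfun_apply (g' t)) (at t within \<sigma>)"
      using g(1) U(2) has_derivative_at_withinI by blast
    then show "(\<phi> has_derivative blinfun_apply (g' t)) (at t within \<sigma>)"
      using U(4) t by (metis has_derivative_transform)
  qed
qed

lemma simplex_of_triangulation:
  assumes "C2_triangulation K \<phi> M" "\<sigma> \<in> K"
  shows "convex \<sigma>" "compact \<sigma>"
  using assms unfolding C2_triangulation_def simplicial_complex_def
  by (meson convex_simplex compact_simplex)+

lemma simplex_deriv_has_derivative:
  assumes "C2_triangulation K \<phi> M" "\<sigma> \<in> K" "t \<in> \<sigma>"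
  shows "(\<phi> has_derivative simplex_deriv \<phi> \<sigma> t) (at t within \<sigma>)"
  using C2_on_simplex_derivative[OF assms(1,2)] assms(3)
  unfolding simplex_deriv_def by (metis differentiable_def frechet_derivative_works)

text \<open>
  The two consequences of \<open>C\<^sup>2\<close> smoothness on which the estimate rests: the differentials along a
  simplex distort lengths by factors bounded away from \<open>0\<close> and \<open>\<infinity>\<close>, and \<open>\<phi>\<close> is uniformly close to its
  differential at nearby points.
\<close>

lemma simplex_deriv_bounds:
  fixes \<phi> :: "'a::euclidean_space \<Rightarrow> 'b::euclidean_space"
  assumes tri: "C2_triangulation K \<phi> M" and \<sigma>: "\<sigma> \<in> K"
  shows "\<exists>m>0. \<exists>\<Lambda>. \<forall>p\<in>\<sigma>. \<forall>w\<in>dir_space \<sigma>.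
           m * norm w \<le> norm (simplex_deriv \<phi> \<sigma> p w) \<and> norm (simplex_deriv \<phi> \<sigma> p w) \<le> \<Lambda> * norm w"
    and "\<eta> > 0 \<Longrightarrow> \<exists>\<delta>>0. \<forall>s\<in>\<sigma>. \<forall>s'\<in>\<sigma>. \<forall>p\<in>\<sigma>. dist s p < \<delta> \<longrightarrow> dist s' p < \<delta> \<longrightarrow>
           norm (\<phi> s - \<phi> s' - simplex_deriv \<phi> \<sigma> p (s - s')) \<le> \<eta> * norm (s - s')"
proof -
  obtain g' :: "'a \<Rightarrow> 'a \<Rightarrow>\<^sub>L 'b"
    where g': "continuous_on \<sigma> g'"
      "\<And>t. t \<in> \<sigma> \<Longrightarrow> (\<phi> has_derivative blinfun_apply (g' t)) (at t within \<sigma>)"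
    using C2_on_simplex_derivative[OF tri \<sigma>] by blast
  note cv = simplex_of_triangulation[OF tri \<sigma>]
  have eq: "simplex_deriv \<phi> \<sigma> p w = g' p w" if "p \<in> \<sigma>" "w \<in> dir_space \<sigma>" for p w
    using has_derivative_within_eq_on_dir_space[OF cv(1) that(1)
        simplex_deriv_has_derivative[OF tri \<sigma> that(1)] g'(2)[OF that(1)] that(2)] .
  have "inj_on (blinfun_apply (g' p)) (dir_space \<sigma>)" if "p \<in> \<sigma>" for p
  proof -
    have "inj_on (simplex_deriv \<phi> \<sigma> p) (dir_space \<sigma>)"
      using tri \<sigma> that unfolding C2_triangulation_def by blast
    then show ?thesis using eq[OF that] by (simp cong: inj_on_cong)
  qed
  from uniform_bounds_on_subspace[OF cv(2) g'(1) subspace_dir_space this]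
  show "\<exists>m>0. \<exists>\<Lambda>. \<forall>p\<in>\<sigma>. \<forall>w\<in>dir_space \<sigma>.
           m * norm w \<le> norm (simplex_deriv \<phi> \<sigma> p w) \<and> norm (simplex_deriv \<phi> \<sigma> p w) \<le> \<Lambda> * norm w"
    using eq by simp
  have diff: "simplex_deriv \<phi> \<sigma> p (s - s') = g' p (s - s')" if "p \<in> \<sigma>" "s \<in> \<sigma>" "s' \<in> \<sigma>" for p s s'
    using eq that diff_in_dir_space by blast
  show "\<exists>\<delta>>0. \<forall>s\<in>\<sigma>. \<forall>s'\<in>\<sigma>. \<forall>p\<in>\<sigma>. dist s p < \<delta> \<longrightarrow> dist s' p < \<delta> \<longrightarrow>
           norm (\<phi> s - \<phi> s' - simplex_deriv \<phi> \<sigma> p (s - s')) \<le> \<eta> * norm (s - s')" if "\<eta> > 0"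
    using uniform_linearization[OF cv(2,1) g' that] by (simp add: diff cong: ball_cong)
qed

section \<open>Simplices and their faces\<close>

text \<open>
  A point of a simplex close to the affine hull of a face is comparably close to the face itself.
  For a proper face, if \<open>s = u f + v g\<close> is a convex combination with \<open>f\<close> in the face and \<open>g\<close> in the opposite face, then \<open>norm (s - f)\<close> is at most \<open>v\<close>
  times the diameter, whereas the distance from \<open>s\<close> to the affine hull is at least \<open>v\<close> times the
  positive distance between that affine hull and the opposite face.
\<close>

lemma face_regularity:
  fixes \<sigma> F :: "'a::euclidean_space set"
  assumes "n simplex \<sigma>" "F face_of \<sigma>" "F \<noteq> {}"
  shows "\<exists>C>0. \<forall>s\<in>\<sigma>. \<exists>f\<in>F. \<forall>a \<in> affine hull F. norm (s - f) \<le> C * norm (s - a)"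
proof (cases "F = \<sigma>")
  case True
  then have "\<forall>s\<in>\<sigma>. \<exists>f\<in>F. \<forall>a \<in> affine hull F. norm (s - f) \<le> 1 * norm (s - a)"
    by (metis diff_self mult_1 norm_ge_zero norm_zero)
  then show ?thesis using zero_less_one by blast
next
  case False
  obtain S where S: "\<not> affine_dependent S" "\<sigma> = convex hull S" and finS: "finite S"
    using assms(1) by (auto simp: simplex)
  obtain T where T: "T \<subseteq> S" "F = convex hull T"
    using assms(2) S face_of_convex_hull_affine_independent by blast
  let ?G = "convex hull (S - T)"
  have ne: "T \<noteq> {}" "S - T \<noteq> {}"
    using assms(3) False S T by auto
  have aff: "affine hull F = affine hull T" using T by simp
  have "affine hull F \<inter> ?G = {}"
    using disjoint_affine_hull[OF S(1) T(1), of "S - T"] aff convex_hull_subset_affine_hull by blast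
  moreover have cG: "compact ?G" using finS by (simp add: finite_imp_compact_convex_hull)
  moreover have "closed (affine hull F)" by simp
  ultimately obtain c where c: "c > 0" "\<And>x y. x \<in> ?G \<Longrightarrow> y \<in> affine hull F \<Longrightarrow> c \<le> dist x y"
    using separate_compact_closed[of ?G "affine hull F"] by blast
  have bnd: "bounded \<sigma>" using assms(1) compact_simplex compact_imp_bounded by blast
  have D0: "diameter \<sigma> \<ge> 0" using bnd by (rule diameter_ge_0)
  let ?C = "(diameter \<sigma> + 1) / c"
  have "?C > 0" using c D0 by simp
  moreover have "\<exists>f\<in>F. \<forall>a \<in> affine hull F. norm (s - f) \<le> ?C * norm (s - a)" if s: "s \<in> \<sigma>" for s
  proof -
    have "\<sigma> = convex hull (F \<union> ?G)"
      using hull_Un[of convex T "S - T"] S(2) T by (simp add: Un_absorb1 convex_Inter)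
    moreover have "convex hull (F \<union> ?G) =
        {u *\<^sub>R f + v *\<^sub>R g | u v f g. u \<ge> 0 \<and> v \<ge> 0 \<and> u + v = 1 \<and> f \<in> F \<and> g \<in> ?G}"
      using ne T by (intro convex_hull_union_two) auto
    ultimately obtain u v f g where uv: "u \<ge> 0" "v \<ge> 0" "u + v = 1" "f \<in> F" "g \<in> ?G"
      and s_eq: "s = u *\<^sub>R f + v *\<^sub>R g"
      using s by blast
    have u: "u = 1 - v" using uv by simp
    have "norm (s - f) \<le> ?C * norm (s - a)" if a: "a \<in> affine hull F" for a
    proof -
      have sf: "s - f = v *\<^sub>R (g - f)" unfolding s_eq u by (simp add: algebra_simps)
      have "f \<in> \<sigma>" "g \<in> \<sigma>"
        using uv T S face_of_imp_subset[OF assms(2)] hull_mono[of "S - T" S convex] by auto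
      then have "norm (g - f) \<le> diameter \<sigma>"
        using bnd by (simp add: diameter_bounded_bound flip: dist_norm)
      then have 1: "norm (s - f) \<le> v * diameter \<sigma>"
        unfolding sf using uv by (simp add: mult_left_mono)
      have 2: "v * c \<le> norm (s - a)"
      proof (cases "v = 0")
        case False
        let ?b = "f + (1/v) *\<^sub>R (a - f)"
        have "(1 - 1/v) *\<^sub>R f + (1/v) *\<^sub>R a \<in> affine hull F"
          using a uv(4) by (intro mem_affine) (auto simp: hull_inc)
        then have "?b \<in> affine hull F" by (simp add: algebra_simps)
        then have "c \<le> norm (g - ?b)" using c(2) uv by (simp add: dist_norm)
        moreover have "s - a = v *\<^sub>R (g - ?b)"
          unfolding s_eq u using False by (simp add: algebra_simps)
        ultimately show ?thesis using uv by (simp add: mult_left_mono)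
      qed simp
      have "norm (s - f) \<le> v * (diameter \<sigma> + 1)" using 1 uv by (simp add: algebra_simps)
      also have "\<dots> = ?C * (v * c)" using c by simp
      also have "\<dots> \<le> ?C * norm (s - a)"
        using 2 \<open>?C > 0\<close> by (intro mult_left_mono) auto
      finally show ?thesis .
    qed
    then show ?thesis using uv by blast
  qed
  ultimately show ?thesis by blast
qed

text \<open>
  Otherwise the part of the segment in \<open>\<sigma>\<close> would be both open and closed in the segment.
\<close>

lemma segment_meets_relative_boundary:
  fixes \<sigma> :: "'a::euclidean_space set"
  assumes "closed \<sigma>" "s \<in> \<sigma>" "s' \<in> affine hull \<sigma>" "s' \<notin> rel_interior \<sigma>"
  shows "\<exists>b \<in> \<sigma> - rel_interior \<sigma>. b \<in> closed_segment s s'"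
proof (rule ccontr)
  let ?T = "closed_segment s s'"
  assume "\<not> ?thesis"
  then have eq: "?T \<inter> \<sigma> = ?T \<inter> rel_interior \<sigma>" using rel_interior_subset by blast
  have T: "?T \<subseteq> affine hull \<sigma>"
    using assms by (meson affine_affine_hull affine_imp_convex closed_segment_subset hull_inc)
  obtain U where U: "open U" "rel_interior \<sigma> = affine hull \<sigma> \<inter> U"
    using openin_rel_interior[of \<sigma>] openin_open by metis
  have "?T \<inter> rel_interior \<sigma> = ?T \<inter> U" using T U by blast
  then have "openin (top_of_set ?T) (?T \<inter> \<sigma>)" using eq U by (metis openin_open_Int)
  moreover have "closedin (top_of_set ?T) (?T \<inter> \<sigma>)" using assms(1) by (rule closedin_closed_Int)
  ultimately have "?T \<inter> \<sigma> = {} \<or> ?T \<inter> \<sigma> = ?T"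
    using connected_segment(1)[of s s'] by (metis connected_clopen)
  then show False using eq assms by auto
qed

lemma affine_hull_eq_dir_space:
  assumes "p \<in> S"
  shows "affine hull S = (\<lambda>u. p + u) ` dir_space S"
proof -
  have "span ((\<lambda>x. - p + x) ` (S - {p})) = dir_space S"
  unfolding dir_space_def
  proof (rule span_eq[THEN iffD2], intro conjI)
    show "(\<lambda>x. - p + x) ` (S - {p}) \<subseteq> span {b - a |a b. a \<in> S \<and> b \<in> S}"
      unfolding dir_space_def[symmetric] using assms diff_in_dir_space by (force simp: algebra_simps)
  next
    have "x - p \<in> span ((\<lambda>x. - p + x) ` (S - {p}))" if "x \<in> S" for x
      using that by (cases "x = p") (auto intro!: span_base simp: span_zero)
    then have "b - a \<in> span ((\<lambda>x. - p + x) ` (S - {p}))" if "a \<in> S" "b \<in> S" for a b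
      using that span_diff[of "b - p" _ "a - p"] by fastforce
    then show "{b - a |a b. a \<in> S \<and> b \<in> S} \<subseteq> span ((\<lambda>x. - p + x) ` (S - {p}))" by blast
  qed
  then show ?thesis using affine_hull_span2[OF assms] by simp
qed

lemma dir_space_feasible_at_rel_interior:
  fixes F :: "'a::euclidean_space set"
  assumes p: "p \<in> rel_interior F" and u: "u \<in> dir_space F"
  shows "\<exists>e>0. p + e *\<^sub>R u \<in> F"
proof -
  have pF: "p \<in> F" using p rel_interior_subset by blast
  obtain r where r: "r > 0" "ball p r \<inter> affine hull F \<subseteq> F"
    using p mem_rel_interior_ball by blast
  define N where "N = norm u + 1"
  define e where "e = r / (2 * N)"
  have nu: "N > 0" by (simp add: N_def add_nonneg_pos)
  then have e: "e > 0" using r by (simp add: e_def)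
  have "norm (e *\<^sub>R u) < r"
  proof -
    have "norm (e *\<^sub>R u) = e * norm u" using e by simp
    also have "\<dots> \<le> e * N" using e by (simp add: N_def)
    also have "\<dots> = r / 2" using nu by (simp add: e_def)
    finally show ?thesis using r by simp
  qed
  moreover have "e *\<^sub>R u \<in> dir_space F" using u by (simp add: subspace_scale)
  then have "p + e *\<^sub>R u \<in> affine hull F"
    using affine_hull_eq_dir_space[OF pF] by blast
  ultimately have "p + e *\<^sub>R u \<in> ball p r \<inter> affine hull F" by (simp add: dist_norm)
  then show ?thesis using r e by blast
qed

lemma smallest_face_eq:
  assumes "F face_of \<sigma>" "p \<in> rel_interior F"
  shows "smallest_face \<sigma> p = F"
proof
  have "p \<in> F" using assms(2) rel_interior_subset by blast
  then show "smallest_face \<sigma> p \<subseteq> F"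
    unfolding smallest_face_def using assms(1) by blast
  show "F \<subseteq> smallest_face \<sigma> p"
    unfolding smallest_face_def
  proof (intro Inter_greatest, clarify)
    fix G x assume "G face_of \<sigma>" "p \<in> G" "x \<in> F"
    then show "x \<in> G"
      using subset_of_face_of[OF _ face_of_imp_subset[OF assms(1)]] assms(2) by blast
  qed
qed

lemma common_face_proper:
  assumes "simplicial_complex K" "\<sigma>\<^sub>1 \<in> K" "\<sigma>\<^sub>2 \<in> K" "n simplex \<sigma>\<^sub>1" "n simplex \<sigma>\<^sub>2" "\<sigma>\<^sub>1 \<noteq> \<sigma>\<^sub>2"
  shows "\<sigma>\<^sub>1 \<inter> \<sigma>\<^sub>2 face_of \<sigma>\<^sub>1" "\<sigma>\<^sub>1 \<inter> \<sigma>\<^sub>2 face_of \<sigma>\<^sub>2" "\<sigma>\<^sub>1 \<inter> \<sigma>\<^sub>2 \<noteq> \<sigma>\<^sub>1"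
proof -
  have *: "\<sigma>\<^sub>1 \<inter> \<sigma>\<^sub>2 face_of \<sigma>\<^sub>1" "\<sigma>\<^sub>2 \<inter> \<sigma>\<^sub>1 face_of \<sigma>\<^sub>2"
    using assms unfolding simplicial_complex_def by blast+
  then show "\<sigma>\<^sub>1 \<inter> \<sigma>\<^sub>2 face_of \<sigma>\<^sub>1" "\<sigma>\<^sub>1 \<inter> \<sigma>\<^sub>2 face_of \<sigma>\<^sub>2" by (simp_all add: Int_commute)
  show "\<sigma>\<^sub>1 \<inter> \<sigma>\<^sub>2 \<noteq> \<sigma>\<^sub>1"
  proof
    assume eq: "\<sigma>\<^sub>1 \<inter> \<sigma>\<^sub>2 = \<sigma>\<^sub>1"
    then have "\<sigma>\<^sub>1 face_of \<sigma>\<^sub>2" using *(2) by (simp add: Int_commute)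
    then have "aff_dim \<sigma>\<^sub>1 < aff_dim \<sigma>\<^sub>2"
      using face_of_aff_dim_lt convex_simplex assms(5,6) by blast
    then show False using aff_dim_simplex[OF assms(4)] aff_dim_simplex[OF assms(5)] by simp
  qed
qed

text \<open>
  A point of \<open>\<sigma>\<close> in the relative interior of a maximal simplex \<open>\<tau>\<close> forces \<open>\<tau> \<subseteq> \<sigma>\<close>, since the face
  \<open>\<tau> \<inter> \<sigma>\<close> of \<open>\<tau>\<close> meets the relative interior of \<open>\<tau>\<close>; then \<open>\<tau> = \<sigma>\<close> by maximality,
  so a boundary point of \<open>\<sigma>\<close> lies in no such relative interior. By injectivity the same holds for its image.
\<close>

lemma boundary_in_skeleton:
  assumes tri: "C2_triangulation K \<phi> M" and \<sigma>: "\<sigma> \<in> K" and b: "b \<in> \<sigma>" "b \<notin> rel_interior \<sigma>"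
  shows "\<phi> b \<in> skeleton K \<phi> M"
proof -
  obtain \<psi> where h: "homeomorphism (\<Union>K) M \<phi> \<psi>"
    using tri unfolding C2_triangulation_def by blast
  have sub: "\<tau> \<inter> \<sigma> face_of \<tau>" if "\<tau> \<in> K" for \<tau>
    using tri \<sigma> that unfolding C2_triangulation_def simplicial_complex_def by blast
  have "\<phi> b \<notin> \<phi> ` rel_interior \<tau>" if \<tau>: "\<tau> \<in> maximal_simplices K" for \<tau>
  proof
    assume "\<phi> b \<in> \<phi> ` rel_interior \<tau>"
    then obtain c where c: "c \<in> rel_interior \<tau>" "\<phi> b = \<phi> c" by blast
    have \<tau>K: "\<tau> \<in> K" using \<tau> by (simp add: maximal_simplices_def)
    have "b = c"
      using h c b \<sigma> \<tau>K rel_interior_subset by (metis UnionI homeomorphism_apply1 subsetD)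
    then have "(\<tau> \<inter> \<sigma>) \<inter> rel_interior \<tau> \<noteq> {}" using b c rel_interior_subset by blast
    then have "\<tau> \<subseteq> \<sigma>" using subset_of_face_of[OF sub[OF \<tau>K], of \<tau>] by blast
    then have "\<sigma> = \<tau>" using \<tau> \<sigma> by (auto simp: maximal_simplices_def)
    then show False using \<open>b = c\<close> b c by blast
  qed
  moreover have "\<phi> b \<in> M" using h b \<sigma> by (auto simp: homeomorphism_def)
  ultimately show ?thesis unfolding skeleton_def by blast
qed

section \<open>Normal inward cones and the strata separation angle\<close>

text \<open>
  Passing to the component of a tangent vector orthogonal to the face stays in the inward cone,
  because from a relatively interior point of the face one can move in every direction of the face.
\<close>

lemma normal_inward_coneI:
  assumes tri: "C2_triangulation K \<phi> M" "\<sigma> \<in> K"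
    and F: "F face_of \<sigma>" "p \<in> rel_interior F"
    and s: "s \<in> \<sigma>" and u: "u \<in> dir_space F"
    and orth: "\<And>y. y \<in> dir_space F \<Longrightarrow>
      orthogonal (simplex_deriv \<phi> \<sigma> p (s - p - u)) (simplex_deriv \<phi> \<sigma> p y)"
  shows "simplex_deriv \<phi> \<sigma> p (s - p - u) \<in> normal_inward_cone \<phi> \<sigma> p"
proof -
  note convex = simplex_of_triangulation(1)[OF tri]
  have pF: "p \<in> F" using F rel_interior_subset by blast
  have F\<sigma>: "F \<subseteq> \<sigma>" using F face_of_imp_subset by blast
  obtain e where e: "e > 0" "p + e *\<^sub>R (- u) \<in> F"
    using dir_space_feasible_at_rel_interior[OF F(2), of "- u"] u by (auto simp: subspace_neg)
  \<comment> \<open>Averaging a step towards \<open>s\<close> with a step along \<open>- u\<close> inside the face.\<close>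
  define c where "c = 1 / (1 + e)"
  have c: "0 < c" "c \<le> 1" "(1 - c) = c * e" using e by (auto simp: c_def field_simps)
  have "(1 - c) *\<^sub>R s + c *\<^sub>R (p + e *\<^sub>R (- u)) \<in> \<sigma>"
    using convexD_alt[OF convex, of s "p + e *\<^sub>R (- u)" c] s e F\<sigma> c by auto
  also have "(1 - c) *\<^sub>R s + c *\<^sub>R (p + e *\<^sub>R (- u)) = p + (c * e) *\<^sub>R (s - p - u)"
    using c(3) by (simp add: algebra_simps flip: c(3))
  finally have "simplex_deriv \<phi> \<sigma> p (s - p - u) \<in> inward_cone \<phi> \<sigma> p"
    unfolding inward_cone_def using c e by (blast intro: mult_pos_pos)
  then show ?thesis
    unfolding normal_inward_cone_def face_tangent_space_def smallest_face_eq[OF F]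
    using orth by blast
qed

lemma normal_inward_cone_scaleR:
  assumes "C2_triangulation K \<phi> M" "\<sigma> \<in> K" "p \<in> \<sigma>" "c > 0" "v \<in> normal_inward_cone \<phi> \<sigma> p"
  shows "c *\<^sub>R v \<in> normal_inward_cone \<phi> \<sigma> p"
proof -
  have lin: "linear (simplex_deriv \<phi> \<sigma> p)"
    using simplex_deriv_has_derivative[OF assms(1-3)] by (rule has_derivative_linear)
  obtain w e where w: "v = simplex_deriv \<phi> \<sigma> p w" "e > 0" "p + e *\<^sub>R w \<in> \<sigma>"
    using assms(5) by (auto simp: normal_inward_cone_def inward_cone_def)
  have "c *\<^sub>R v = simplex_deriv \<phi> \<sigma> p (c *\<^sub>R w)" "e / c > 0" "p + (e / c) *\<^sub>R (c *\<^sub>R w) \<in> \<sigma>"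
    using w lin \<open>c > 0\<close> by (simp_all add: linear_scale)
  then have "c *\<^sub>R v \<in> inward_cone \<phi> \<sigma> p" unfolding inward_cone_def by blast
  then show ?thesis
    using assms(5) by (simp add: normal_inward_cone_def orthogonal_def)
qed

lemma spherical_setdist_le:
  assumes "u \<in> A" "norm u = 1" "v \<in> B" "norm v = 1"
  shows "spherical_setdist A B \<le> arccos (u \<bullet> v)"
proof -
  have ne: "u \<in> A \<inter> sphere 0 1" "v \<in> B \<inter> sphere 0 1" using assms by auto
  have "0 \<le> arccos (x \<bullet> y)" if "norm x = 1" "norm y = 1" for x y :: 'a
    using Cauchy_Schwarz_ineq2[of x y] that by (intro arccos_lbound) auto
  then have "bdd_below {arccos (u \<bullet> v) | u v. u \<in> A \<inter> sphere 0 1 \<and> v \<in> B \<inter> sphere 0 1}"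
    by (intro bdd_belowI[of _ 0]) auto
  then have "Inf {arccos (u \<bullet> v) | u v. u \<in> A \<inter> sphere 0 1 \<and> v \<in> B \<inter> sphere 0 1} \<le> arccos (u \<bullet> v)"
    using ne by (intro cInf_lower) blast+
  then show ?thesis using ne unfolding spherical_setdist_def by auto
qed

lemma spherical_setdist_bounds: "0 \<le> spherical_setdist A B" "spherical_setdist A B \<le> pi"
proof -
  have *: "0 \<le> arccos (x \<bullet> y) \<and> arccos (x \<bullet> y) \<le> pi" if "norm x = 1" "norm y = 1" for x y :: 'a
    using Cauchy_Schwarz_ineq2[of x y] that arccos_bounded[of "x \<bullet> y"] by auto
  show "0 \<le> spherical_setdist A B"
  proof (cases "A \<inter> sphere 0 1 = {} \<or> B \<inter> sphere 0 1 = {}")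
    case True
    then show ?thesis by (simp add: spherical_setdist_def)
  next
    case False
    then have "0 \<le> Inf {arccos (u \<bullet> v) | u v. u \<in> A \<inter> sphere 0 1 \<and> v \<in> B \<inter> sphere 0 1}"
      using * by (intro cInf_greatest) auto
    then show ?thesis using False by (auto simp: spherical_setdist_def)
  qed
  show "spherical_setdist A B \<le> pi"
  proof (cases "A \<inter> sphere 0 1 = {} \<or> B \<inter> sphere 0 1 = {}")
    case True
    then show ?thesis by (simp add: spherical_setdist_def)
  next
    case False
    then obtain u v where "u \<in> A" "norm u = 1" "v \<in> B" "norm v = 1" by auto
    then show ?thesis using spherical_setdist_le[of u A v B] *[of u v] by linarith
  qed
qed

lemma strata_separation_angle_le:
  assumes "\<sigma>\<^sub>1 \<in> K" "\<sigma>\<^sub>2 \<in> K" "int d simplex \<sigma>\<^sub>1" "int d simplex \<sigma>\<^sub>2" "\<sigma>\<^sub>1 \<noteq> \<sigma>\<^sub>2"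
    and "p \<in> rel_interior (\<sigma>\<^sub>1 \<inter> \<sigma>\<^sub>2)"
  shows "strata_separation_angle d K \<phi>
           \<le> spherical_setdist (normal_inward_cone \<phi> \<sigma>\<^sub>1 p) (normal_inward_cone \<phi> \<sigma>\<^sub>2 p)"
proof -
  define A where "A = {spherical_setdist (normal_inward_cone \<phi> \<sigma>\<^sub>1 p) (normal_inward_cone \<phi> \<sigma>\<^sub>2 p) | \<sigma>\<^sub>1 \<sigma>\<^sub>2 p.
                 \<sigma>\<^sub>1 \<in> K \<and> \<sigma>\<^sub>2 \<in> K \<and> int d simplex \<sigma>\<^sub>1 \<and> int d simplex \<sigma>\<^sub>2 \<and>
                 \<sigma>\<^sub>1 \<noteq> \<sigma>\<^sub>2 \<and> \<sigma>\<^sub>1 \<inter> \<sigma>\<^sub>2 \<noteq> {} \<and> p \<in> rel_interior (\<sigma>\<^sub>1 \<inter> \<sigma>\<^sub>2)}"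
  have mem: "spherical_setdist (normal_inward_cone \<phi> \<sigma>\<^sub>1 p) (normal_inward_cone \<phi> \<sigma>\<^sub>2 p) \<in> A"
    using assms rel_interior_subset unfolding A_def by blast
  moreover have "bdd_below A"
    unfolding A_def by (intro bdd_belowI[of _ 0]) (auto simp: spherical_setdist_bounds)
  ultimately have "Inf A \<le> spherical_setdist (normal_inward_cone \<phi> \<sigma>\<^sub>1 p) (normal_inward_cone \<phi> \<sigma>\<^sub>2 p)"
    by (rule cInf_lower)
  moreover have "strata_separation_angle d K \<phi> = Inf A"
    unfolding strata_separation_angle_def A_def[symmetric] Let_def using mem by auto
  ultimately show ?thesis by simp
qed

text \<open>
  In the triangle with vertices \<open>0\<close>, \<open>v\<^sub>1\<close>, \<open>v\<^sub>2\<close>, whose angle at \<open>0\<close> is at least \<open>\<theta>\<close>, the side opposite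
  to \<open>0\<close> has length at least \<open>norm v\<^sub>1\<close> times \<open>sin \<theta>\<close> if \<open>\<theta> \<le> pi / 2\<close>, and at least \<open>norm v\<^sub>1\<close>
  otherwise. Replacing the angle by the smaller one \<open>\<theta> / 2\<close>, which is never obtuse, and then its sine
  by \<open>sin (\<theta> / 4)\<close> gives one bound for all \<open>\<theta>\<close> in \<open>[0, pi]\<close>.
\<close>

lemma norm_diff_ge_of_spherical_setdist:
  fixes A B :: "'b::euclidean_space set"
  assumes dist: "0 \<le> \<theta>" "\<theta> \<le> spherical_setdist A B"
    and v: "v\<^sub>1 \<in> A" "v\<^sub>2 \<in> B"
    and cone: "\<And>c v. c > 0 \<Longrightarrow> v \<in> A \<Longrightarrow> c *\<^sub>R v \<in> A" "\<And>c v. c > 0 \<Longrightarrow> v \<in> B \<Longrightarrow> c *\<^sub>R v \<in> B"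
  shows "sin (\<theta> / 4) * norm v\<^sub>1 \<le> norm (v\<^sub>1 - v\<^sub>2)"
proof (cases "v\<^sub>1 = 0 \<or> v\<^sub>2 = 0")
  case True
  then show ?thesis
    using mult_right_mono[OF sin_le_one, of "norm v\<^sub>1" "\<theta> / 4"] by auto
next
  case False
  define q where "q = sin (\<theta> / 4)"
  define a where "a = norm v\<^sub>1"
  define b where "b = norm v\<^sub>2"
  have \<theta>: "\<theta> \<le> pi" using dist spherical_setdist_bounds(2)[of A B] by linarith
  have ab: "a > 0" "b > 0" using False by (auto simp: a_def b_def)
  let ?c = "(v\<^sub>1 /\<^sub>R a) \<bullet> (v\<^sub>2 /\<^sub>R b)"
  have n: "norm (v\<^sub>1 /\<^sub>R a) = 1" "norm (v\<^sub>2 /\<^sub>R b) = 1"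
    using ab by (auto simp: a_def b_def)
  have c: "\<bar>?c\<bar> \<le> 1" using Cauchy_Schwarz_ineq2[of "v\<^sub>1 /\<^sub>R a" "v\<^sub>2 /\<^sub>R b"] n by simp
  have "\<theta> / 2 \<le> arccos ?c"
    using dist spherical_setdist_le[OF cone(1)[OF _ v(1), of "inverse a"] n(1) cone(2)[OF _ v(2), of "inverse b"] n(2)]
      ab by simp
  then have "cos (arccos ?c) \<le> cos (\<theta> / 2)"
    using dist c by (intro cos_monotone_0_pi_le) (auto simp: arccos_ubound)
  then have "?c \<le> 1 - 2 * q\<^sup>2"
    using c cos_double_sin[of "\<theta> / 4"] by (simp add: q_def abs_le_iff)
  then have inner: "v\<^sub>1 \<bullet> v\<^sub>2 \<le> a * b * (1 - 2 * q\<^sup>2)"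
    using ab by (simp add: field_simps)
  have "0 \<le> cos (\<theta> / 2)" using dist \<theta> by (intro cos_ge_zero) auto
  then have q: "2 * q\<^sup>2 \<le> 1" using cos_double_sin[of "\<theta> / 4"] by (simp add: q_def)
  \<comment> \<open>Completing the square, where \<open>1 - 2 * q\<^sup>2\<close> is the cosine of the angle \<open>\<theta> / 2\<close>.\<close>
  have "0 \<le> (b - a * (1 - 2 * q\<^sup>2))\<^sup>2 + a\<^sup>2 * q\<^sup>2 * (3 - 4 * q\<^sup>2)"
    using q by (intro add_nonneg_nonneg mult_nonneg_nonneg) auto
  also have "\<dots> = a\<^sup>2 + b\<^sup>2 - 2 * (a * b * (1 - 2 * q\<^sup>2)) - (q * a)\<^sup>2"
    by (simp add: power2_eq_square algebra_simps)
  finally have "(q * a)\<^sup>2 \<le> a\<^sup>2 + b\<^sup>2 - 2 * (a * b * (1 - 2 * q\<^sup>2))" by simp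
  also have "\<dots> \<le> a\<^sup>2 + b\<^sup>2 - 2 * (v\<^sub>1 \<bullet> v\<^sub>2)" using inner by simp
  also have "\<dots> = (norm (v\<^sub>1 - v\<^sub>2))\<^sup>2"
    by (simp add: a_def b_def power2_norm_eq_inner inner_diff inner_commute)
  finally show ?thesis unfolding q_def a_def by (rule power2_le_imp_le) simp
qed

text \<open>
  The estimate for the linearized problem. For the \<open>u\<close> constructed here,
  \<open>simplex_deriv \<phi> \<sigma>\<^sub>1 p u\<close> is the orthogonal projection
  of \<open>simplex_deriv \<phi> \<sigma>\<^sub>1 p (s\<^sub>1 - p)\<close> to the tangent space \<open>T\<close> of the common face, so the left-hand norms
  are the distance of that vector from \<open>T\<close>. The components of both tangent vectors
  orthogonal to \<open>T\<close> lie in the two normal inward cones, hence span an angle at least the strata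
  separation angle, and the orthogonal projection along \<open>T\<close> does not increase the distance between them.
\<close>

lemma tangent_distance_to_common_face:
  fixes K :: "'a::euclidean_space set set" and \<phi> :: "'a \<Rightarrow> 'b::euclidean_space"
  assumes tri: "C2_triangulation K \<phi> M"
    and \<sigma>: "\<sigma>\<^sub>1 \<in> K" "\<sigma>\<^sub>2 \<in> K" "int d simplex \<sigma>\<^sub>1" "int d simplex \<sigma>\<^sub>2" "\<sigma>\<^sub>1 \<noteq> \<sigma>\<^sub>2"
    and angle: "strata_separation_angle d K \<phi> \<ge> 0"
    and p: "p \<in> rel_interior (\<sigma>\<^sub>1 \<inter> \<sigma>\<^sub>2)"
    and s: "s\<^sub>1 \<in> \<sigma>\<^sub>1" "s\<^sub>2 \<in> \<sigma>\<^sub>2"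
  shows "\<exists>u \<in> dir_space (\<sigma>\<^sub>1 \<inter> \<sigma>\<^sub>2).
           sin (strata_separation_angle d K \<phi> / 4) * norm (simplex_deriv \<phi> \<sigma>\<^sub>1 p (s\<^sub>1 - p - u))
             \<le> norm (simplex_deriv \<phi> \<sigma>\<^sub>1 p (s\<^sub>1 - p) - simplex_deriv \<phi> \<sigma>\<^sub>2 p (s\<^sub>2 - p)) \<and>
           norm (simplex_deriv \<phi> \<sigma>\<^sub>1 p (s\<^sub>1 - p - u)) \<le> norm (simplex_deriv \<phi> \<sigma>\<^sub>1 p (s\<^sub>1 - p))"
proof -
  define F where "F = \<sigma>\<^sub>1 \<inter> \<sigma>\<^sub>2"
  define L\<^sub>1 where "L\<^sub>1 = simplex_deriv \<phi> \<sigma>\<^sub>1 p"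
  define L\<^sub>2 where "L\<^sub>2 = simplex_deriv \<phi> \<sigma>\<^sub>2 p"
  define w\<^sub>1 where "w\<^sub>1 = s\<^sub>1 - p"
  define w\<^sub>2 where "w\<^sub>2 = s\<^sub>2 - p"
  note p = p[folded F_def]
  have cx: "simplicial_complex K" using tri by (simp add: C2_triangulation_def)
  have F: "F face_of \<sigma>\<^sub>1" "F face_of \<sigma>\<^sub>2"
    unfolding F_def using common_face_proper[OF cx \<sigma>] by auto
  have F\<sigma>: "F \<subseteq> \<sigma>\<^sub>1" "F \<subseteq> \<sigma>\<^sub>2" by (auto simp: F_def)
  have convF: "convex F"
    unfolding F_def using simplex_of_triangulation(1)[OF tri] \<sigma>(1,2) by (simp add: convex_Int)
  have pF: "p \<in> F" using p rel_interior_subset by blast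
  then have p\<sigma>: "p \<in> \<sigma>\<^sub>1" "p \<in> \<sigma>\<^sub>2" using F\<sigma> by auto
  note der = simplex_deriv_has_derivative[OF tri \<sigma>(1) p\<sigma>(1), folded L\<^sub>1_def]
    simplex_deriv_has_derivative[OF tri \<sigma>(2) p\<sigma>(2), folded L\<^sub>2_def]
  have lin: "linear L\<^sub>1" "linear L\<^sub>2"
    using der has_derivative_linear by blast+
  have agree: "L\<^sub>1 u = L\<^sub>2 u" if "u \<in> dir_space F" for u
    using has_derivative_within_eq_on_dir_space[OF convF pF
        has_derivative_subset[OF der(1) F\<sigma>(1)] has_derivative_subset[OF der(2) F\<sigma>(2)] that] .
  have split: "\<exists>u\<in>dir_space F. \<forall>y\<in>dir_space F. orthogonal (x - L\<^sub>1 u) (L\<^sub>1 y)" for x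
  proof -
    obtain y z where yz: "y \<in> span (L\<^sub>1 ` dir_space F)"
      "\<And>w. w \<in> span (L\<^sub>1 ` dir_space F) \<Longrightarrow> orthogonal z w" "x = y + z"
      using orthogonal_subspace_decomp_exists[of "L\<^sub>1 ` dir_space F" x] by blast
    moreover have "span (L\<^sub>1 ` dir_space F) = L\<^sub>1 ` dir_space F"
      using lin by (simp add: span_eq_iff linear_subspace_image)
    ultimately show ?thesis by force
  qed
  obtain u\<^sub>1 where u1: "u\<^sub>1 \<in> dir_space F"
    "\<And>y. y \<in> dir_space F \<Longrightarrow> orthogonal (L\<^sub>1 w\<^sub>1 - L\<^sub>1 u\<^sub>1) (L\<^sub>1 y)"
    using split by blast
  obtain u\<^sub>2 where u2: "u\<^sub>2 \<in> dir_space F"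
    "\<And>y. y \<in> dir_space F \<Longrightarrow> orthogonal (L\<^sub>2 w\<^sub>2 - L\<^sub>1 u\<^sub>2) (L\<^sub>1 y)"
    using split by blast
  define v\<^sub>1 where "v\<^sub>1 = L\<^sub>1 (w\<^sub>1 - u\<^sub>1)"
  define v\<^sub>2 where "v\<^sub>2 = L\<^sub>2 (w\<^sub>2 - u\<^sub>2)"
  have v1: "v\<^sub>1 = L\<^sub>1 w\<^sub>1 - L\<^sub>1 u\<^sub>1" using lin by (simp add: v\<^sub>1_def linear_diff)
  have v2: "v\<^sub>2 = L\<^sub>2 w\<^sub>2 - L\<^sub>1 u\<^sub>2"
    using lin agree[OF u2(1)] by (simp add: v\<^sub>2_def linear_diff)
  have "v\<^sub>1 \<in> normal_inward_cone \<phi> \<sigma>\<^sub>1 p"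
    using normal_inward_coneI[OF tri \<sigma>(1) F(1) p s(1) u1(1)] u1(2) v1
    by (simp add: v\<^sub>1_def w\<^sub>1_def L\<^sub>1_def)
  moreover have "v\<^sub>2 \<in> normal_inward_cone \<phi> \<sigma>\<^sub>2 p"
    using normal_inward_coneI[OF tri \<sigma>(2) F(2) p s(2) u2(1)] u2(2) v2 agree
    by (simp add: v\<^sub>2_def w\<^sub>2_def L\<^sub>2_def)
  ultimately have qv: "sin (strata_separation_angle d K \<phi> / 4) * norm v\<^sub>1 \<le> norm (v\<^sub>1 - v\<^sub>2)"
    by (intro norm_diff_ge_of_spherical_setdist[OF angle strata_separation_angle_le[OF \<sigma> p[unfolded F_def]]])
       (auto intro: normal_inward_cone_scaleR[OF tri \<sigma>(1) p\<sigma>(1)] normal_inward_cone_scaleR[OF tri \<sigma>(2) p\<sigma>(2)])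
  have "orthogonal v\<^sub>1 (L\<^sub>1 (u\<^sub>1 - u\<^sub>2))" "orthogonal v\<^sub>2 (L\<^sub>1 (u\<^sub>1 - u\<^sub>2))"
    "orthogonal v\<^sub>1 (L\<^sub>1 u\<^sub>1)"
    unfolding v1 v2 using u1 u2 by (simp_all add: subspace_diff)
  then have orth: "orthogonal (v\<^sub>1 - v\<^sub>2) (L\<^sub>1 (u\<^sub>1 - u\<^sub>2))" "orthogonal v\<^sub>1 (L\<^sub>1 u\<^sub>1)"
    by (auto simp: orthogonal_def inner_diff_left)
  have "L\<^sub>1 w\<^sub>1 - L\<^sub>2 w\<^sub>2 = (v\<^sub>1 - v\<^sub>2) + L\<^sub>1 (u\<^sub>1 - u\<^sub>2)"
    using lin by (simp add: v1 v2 linear_diff)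
  then have "(norm (v\<^sub>1 - v\<^sub>2))\<^sup>2 \<le> (norm (L\<^sub>1 w\<^sub>1 - L\<^sub>2 w\<^sub>2))\<^sup>2"
    using norm_add_Pythagorean[OF orth(1)] by simp
  then have vd: "norm (v\<^sub>1 - v\<^sub>2) \<le> norm (L\<^sub>1 w\<^sub>1 - L\<^sub>2 w\<^sub>2)" by (rule power2_le_imp_le) simp
  have "L\<^sub>1 w\<^sub>1 = v\<^sub>1 + L\<^sub>1 u\<^sub>1" by (simp add: v1)
  then have "(norm v\<^sub>1)\<^sup>2 \<le> (norm (L\<^sub>1 w\<^sub>1))\<^sup>2"
    using norm_add_Pythagorean[OF orth(2)] by simp
  then have vw: "norm v\<^sub>1 \<le> norm (L\<^sub>1 w\<^sub>1)" by (rule power2_le_imp_le) simp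
  show ?thesis
    using u1(1) order_trans[OF qv vd] vw
    unfolding F_def v\<^sub>1_def w\<^sub>1_def w\<^sub>2_def L\<^sub>1_def L\<^sub>2_def by blast
qed

section \<open>Distance to the skeleton\<close>

text \<open>
  The pairs that are not close to a common point form a compact set on which \<open>\<phi>\<close> separates the two
  members, by injectivity. If \<open>A\<close> and \<open>B\<close> are disjoint, this set contains all pairs, so that \<open>r\<close> is smaller
  than the distance of the two images.
\<close>

lemma near_pairs_near_common_points:
  fixes A B :: "'a::euclidean_space set" and \<phi> :: "'a \<Rightarrow> 'b::euclidean_space"
  assumes "compact A" "compact B" and cont: "continuous_on A \<phi>" "continuous_on B \<phi>"
    and inj: "inj_on \<phi> (A \<union> B)" and "\<delta> > 0"
  shows "\<exists>r>0. \<forall>s\<^sub>1\<in>A. \<forall>s\<^sub>2\<in>B. norm (\<phi> s\<^sub>1 - \<phi> s\<^sub>2) \<le> r \<longrightarrow>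
           (\<exists>q\<in>A \<inter> B. dist s\<^sub>1 q + dist s\<^sub>1 s\<^sub>2 < \<delta>)"
proof -
  let ?N = "(A \<times> B) \<inter> (\<Inter>q\<in>A \<inter> B. {z. \<delta> \<le> dist (fst z) q + dist (fst z) (snd z)})"
  have comp: "compact ?N"
    using assms by (intro compact_Int_closed compact_Times closed_INT ballI closed_Collect_le continuous_intros)
  have cont': "continuous_on ?N (\<lambda>z. norm (\<phi> (fst z) - \<phi> (snd z)))"
    by (intro continuous_intros continuous_on_compose2[OF cont(1)] continuous_on_compose2[OF cont(2)]) auto
  show ?thesis
  proof (cases "?N = {}")
    case True
    have "\<exists>q\<in>A \<inter> B. dist s\<^sub>1 q + dist s\<^sub>1 s\<^sub>2 < \<delta>" if "s\<^sub>1 \<in> A" "s\<^sub>2 \<in> B" for s\<^sub>1 s\<^sub>2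
    proof (rule ccontr)
      assume "\<not> ?thesis"
      then have "(s\<^sub>1, s\<^sub>2) \<in> ?N" using that by (auto simp: not_less)
      with True show False by blast
    qed
    then show ?thesis using zero_less_one by blast
  next
    case False
    obtain z where z: "z \<in> ?N"
      "\<And>y. y \<in> ?N \<Longrightarrow> norm (\<phi> (fst z) - \<phi> (snd z)) \<le> norm (\<phi> (fst y) - \<phi> (snd y))"
      using continuous_attains_inf[OF comp False cont'] by blast
    let ?r = "norm (\<phi> (fst z) - \<phi> (snd z))"
    have "?r > 0"
    proof (rule ccontr)
      assume "\<not> ?r > 0"
      moreover have zAB: "fst z \<in> A" "snd z \<in> B" using z(1) by auto
      ultimately have "fst z = snd z" using inj by (auto simp: inj_on_def)
      then have "fst z \<in> A \<inter> B" using zAB by simp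
      then have "\<delta> \<le> dist (fst z) (fst z) + dist (fst z) (snd z)" using z(1) by blast
      then show False using \<open>fst z = snd z\<close> \<open>\<delta> > 0\<close> by simp
    qed
    moreover have "\<exists>q\<in>A \<inter> B. dist s\<^sub>1 q + dist s\<^sub>1 s\<^sub>2 < \<delta>"
      if "s\<^sub>1 \<in> A" "s\<^sub>2 \<in> B" "norm (\<phi> s\<^sub>1 - \<phi> s\<^sub>2) \<le> ?r / 2" for s\<^sub>1 s\<^sub>2
    proof (rule ccontr)
      assume "\<not> ?thesis"
      then have "(s\<^sub>1, s\<^sub>2) \<in> ?N" using that by (auto simp: not_less)
      from z(2)[OF this] that(3) \<open>?r > 0\<close> show False by simp
    qed
    ultimately show ?thesis by (intro exI[of _ "?r / 2"]) auto
  qed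
qed

text \<open>
  The bookkeeping of errors. In its application, \<open>V\<close> is the distance of the first tangent vector
  from the tangent space of the common face, \<open>W\<^sub>1\<close> and \<open>W\<^sub>2\<close> are the distances in the domain from the base
  point, and \<open>e\<close> is the distance of the two image points. For \<open>\<eta> = 0\<close> one would have \<open>V \<le> e / q\<close>; the
  factor \<open>2\<close> absorbs the linearization errors, because they are small multiples of \<open>V\<close> and \<open>e\<close>
  themselves.
\<close>

lemma perturbed_estimate:
  fixes m q e V W\<^sub>1 W\<^sub>2 B \<Lambda> \<eta> :: real
  assumes "m > 0" "q > 0" "B \<ge> 0" "\<Lambda> \<ge> 0" "V \<ge> 0" "e \<ge> 0" "W\<^sub>1 \<ge> 0" "W\<^sub>2 \<ge> 0"
    and \<eta>: "0 < \<eta>" "\<eta> \<le> 1" "\<eta> \<le> m / 10" "\<eta> * (B + 2 / m * ((\<Lambda> + 1) * B)) \<le> q / 5"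
    and W1: "W\<^sub>1 \<le> B * V"
    and W2: "m * W\<^sub>2 \<le> e + (\<Lambda> + \<eta>) * W\<^sub>1 + \<eta> * W\<^sub>2"
    and V: "q * V \<le> e + \<eta> * W\<^sub>1 + \<eta> * W\<^sub>2"
  shows "(1 + \<eta> / m) * V \<le> 2 * e / q"
proof -
  have "(\<Lambda> + \<eta>) * W\<^sub>1 \<le> (\<Lambda> + 1) * (B * V)"
    using assms by (intro mult_mono) auto
  moreover have "\<eta> * W\<^sub>2 \<le> (m * W\<^sub>2) / 10"
    using mult_right_mono[OF \<eta>(3), of W\<^sub>2] assms by simp
  moreover have "m * W\<^sub>2 \<ge> 0" using assms by simp
  ultimately have "m * W\<^sub>2 \<le> 2 * (e + (\<Lambda> + 1) * (B * V))" using W2 \<open>e \<ge> 0\<close> by argo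
  then have W2': "W\<^sub>2 \<le> 2 / m * (e + (\<Lambda> + 1) * (B * V))"
    using \<open>m > 0\<close> by (simp add: field_simps)
  have "\<eta> * W\<^sub>1 + \<eta> * W\<^sub>2 \<le> \<eta> * (B * V) + \<eta> * (2 / m * (e + (\<Lambda> + 1) * (B * V)))"
    using W1 W2' \<eta>(1) by (intro add_mono mult_left_mono) auto
  also have "\<dots> = (\<eta> / m) * (2 * e) + \<eta> * (B + 2 / m * ((\<Lambda> + 1) * B)) * V"
    using \<open>m > 0\<close> by (simp add: field_simps)
  also have "\<dots> \<le> (1 / 10) * (2 * e) + q / 5 * V"
    using assms by (intro add_mono mult_right_mono) (auto simp: field_simps)
  finally have "q * V \<le> 3 / 2 * e" using V by simp
  moreover have "(1 + \<eta> / m) * (q * V) \<le> (11 / 10) * (q * V)"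
    using assms by (intro mult_right_mono) (auto simp: field_simps)
  ultimately have "(1 + \<eta> / m) * (q * V) \<le> 2 * e" using \<open>e \<ge> 0\<close> by linarith
  then have "(1 + \<eta> / m) * V * q \<le> 2 * e" by (simp add: mult_ac)
  then show ?thesis using \<open>q > 0\<close> by (simp add: pos_le_divide_eq)
qed

text \<open>
  The linearized estimate transfers to \<open>\<phi>\<close> only because every linearization error is controlled by
  the quantities being compared. This dictates the base point \<open>p\<close>: it must be relatively interior to the
  common face \<open>F\<close>, for the separation angle to apply, and its distance to \<open>s\<^sub>1\<close> must be comparable to the
  distance from \<open>s\<^sub>1\<close> to the affine hull of \<open>F\<close>. The foot of the perpendicular from \<open>s\<^sub>1\<close> (perpendicular
  for the metric pulled back by the differential at \<open>p\<close>) need not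
  lie in \<open>F\<close>, only in its affine hull; but in any case the segment to it leaves \<open>\<sigma>\<^sub>1\<close> through a boundary
  point, which is why the bound concerns the skeleton and not just the image of \<open>F\<close>.
\<close>

lemma distance_to_skeleton_near_another_simplex:
  fixes K :: "'a::euclidean_space set set" and \<phi> :: "'a \<Rightarrow> 'b::euclidean_space"
  assumes adm: "admissible_triangulation d K \<phi> M"
    and \<sigma>: "\<sigma>\<^sub>1 \<in> K" "\<sigma>\<^sub>2 \<in> K" "int d simplex \<sigma>\<^sub>1" "int d simplex \<sigma>\<^sub>2" "\<sigma>\<^sub>1 \<noteq> \<sigma>\<^sub>2"
  shows "\<exists>r>0. \<forall>s\<^sub>1\<in>\<sigma>\<^sub>1. \<forall>s\<^sub>2\<in>\<sigma>\<^sub>2. norm (\<phi> s\<^sub>1 - \<phi> s\<^sub>2) \<le> r \<longrightarrow>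
           infdist (\<phi> s\<^sub>1) (skeleton K \<phi> M)
             \<le> 2 * norm (\<phi> s\<^sub>1 - \<phi> s\<^sub>2) / sin (strata_separation_angle d K \<phi> / 4)"
proof -
  define \<theta> where "\<theta> = strata_separation_angle d K \<phi>"
  define q where "q = sin (\<theta> / 4)"
  define F where "F = \<sigma>\<^sub>1 \<inter> \<sigma>\<^sub>2"
  define L\<^sub>1 where "L\<^sub>1 = simplex_deriv \<phi> \<sigma>\<^sub>1"
  define L\<^sub>2 where "L\<^sub>2 = simplex_deriv \<phi> \<sigma>\<^sub>2"
  have tri: "C2_triangulation K \<phi> M" and \<theta>0: "\<theta> > 0"
    using adm by (auto simp: admissible_triangulation_def \<theta>_def)
  have cx: "simplicial_complex K" using tri by (simp add: C2_triangulation_def)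
  obtain \<psi> where h: "homeomorphism (\<Union>K) M \<phi> \<psi>"
    using tri by (auto simp: C2_triangulation_def)
  have cont: "continuous_on (\<Union>K) \<phi>" using h by (simp add: homeomorphism_def)
  have inj: "inj_on \<phi> (\<sigma>\<^sub>1 \<union> \<sigma>\<^sub>2)"
    using h \<sigma>(1,2) by (intro inj_onI) (metis UnE UnionI homeomorphism_apply1)
  have contact: "\<exists>r>0. \<forall>s\<^sub>1\<in>\<sigma>\<^sub>1. \<forall>s\<^sub>2\<in>\<sigma>\<^sub>2. norm (\<phi> s\<^sub>1 - \<phi> s\<^sub>2) \<le> r \<longrightarrow>
           (\<exists>q\<in>F. dist s\<^sub>1 q + dist s\<^sub>1 s\<^sub>2 < \<delta>)" if "\<delta> > 0" for \<delta>
    unfolding F_def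
    using \<sigma>(1,2) that inj simplex_of_triangulation[OF tri]
    by (intro near_pairs_near_common_points continuous_on_subset[OF cont]) auto
  have F: "F face_of \<sigma>\<^sub>1" "F \<noteq> \<sigma>\<^sub>1"
    unfolding F_def using common_face_proper[OF cx \<sigma>] by auto
  have F\<sigma>: "F \<subseteq> \<sigma>\<^sub>1" "F \<subseteq> \<sigma>\<^sub>2" by (auto simp: F_def)
  note conv = simplex_of_triangulation(1)[OF tri \<sigma>(1)] simplex_of_triangulation(1)[OF tri \<sigma>(2)]
  show ?thesis
  proof (cases "F = {}")
    case True
    then show ?thesis using contact[of 1] by auto
  next
    case False
    have convF: "convex F" unfolding F_def using conv by (rule convex_Int)
    have "rel_interior F \<noteq> {}" using False convF rel_interior_eq_empty by blast
    then have \<theta>pi: "\<theta> \<le> pi"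
      unfolding \<theta>_def F_def
      using strata_separation_angle_le[OF \<sigma>] spherical_setdist_bounds(2) order_trans by blast
    have q0: "q > 0" unfolding q_def using \<theta>0 \<theta>pi by (intro sin_gt_zero) auto
    obtain m\<^sub>1 \<Lambda>\<^sub>1 where m1: "m\<^sub>1 > 0" "\<And>p w. p \<in> \<sigma>\<^sub>1 \<Longrightarrow> w \<in> dir_space \<sigma>\<^sub>1 \<Longrightarrow>
        m\<^sub>1 * norm w \<le> norm (L\<^sub>1 p w) \<and> norm (L\<^sub>1 p w) \<le> \<Lambda>\<^sub>1 * norm w"
      using simplex_deriv_bounds(1)[OF tri \<sigma>(1)] unfolding L\<^sub>1_def by blast
    obtain m\<^sub>2 \<Lambda>\<^sub>2 where m2: "m\<^sub>2 > 0" "\<And>p w. p \<in> \<sigma>\<^sub>2 \<Longrightarrow> w \<in> dir_space \<sigma>\<^sub>2 \<Longrightarrow>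
        m\<^sub>2 * norm w \<le> norm (L\<^sub>2 p w) \<and> norm (L\<^sub>2 p w) \<le> \<Lambda>\<^sub>2 * norm w"
      using simplex_deriv_bounds(1)[OF tri \<sigma>(2)] unfolding L\<^sub>2_def by blast
    define m where "m = min m\<^sub>1 m\<^sub>2"
    define \<Lambda> where "\<Lambda> = max 0 \<Lambda>\<^sub>1"
    have m: "m > 0" "\<Lambda> \<ge> 0" using m1 m2 by (auto simp: m_def \<Lambda>_def)
    have low1: "m * norm w \<le> norm (L\<^sub>1 p w)" and up1: "norm (L\<^sub>1 p w) \<le> \<Lambda> * norm w"
      if "p \<in> \<sigma>\<^sub>1" "w \<in> dir_space \<sigma>\<^sub>1" for p w
      using m1(2)[OF that] mult_right_mono[of m m\<^sub>1 "norm w"] mult_right_mono[of \<Lambda>\<^sub>1 \<Lambda> "norm w"]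
      by (auto simp: m_def \<Lambda>_def)
    have low2: "m * norm w \<le> norm (L\<^sub>2 p w)" if "p \<in> \<sigma>\<^sub>2" "w \<in> dir_space \<sigma>\<^sub>2" for p w
      using m2(2)[OF that] mult_right_mono[of m m\<^sub>2 "norm w"] by (auto simp: m_def)
    obtain C where C: "C > 0"
      "\<And>s. s \<in> \<sigma>\<^sub>1 \<Longrightarrow> \<exists>f\<in>F. \<forall>a\<in>affine hull F. norm (s - f) \<le> C * norm (s - a)"
      using face_regularity[OF \<sigma>(3) F(1) False] by blast
    \<comment> \<open>\<open>B\<close> will bound the distance from \<open>s\<^sub>1\<close> to \<open>p\<close> in terms of \<open>norm v\<^sub>1\<close>, with \<open>v\<^sub>1\<close> as below, and \<open>Q\<close> the sum of
      the distances of both points to \<open>p\<close>, apart from a multiple of \<open>norm (\<phi> s\<^sub>1 - \<phi> s\<^sub>2)\<close>.\<close>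
    define B where "B = 2 * C / m"
    define Q where "Q = B + 2 / m * ((\<Lambda> + 1) * B)"
    have B: "B \<ge> 0" "Q \<ge> 0" using C m by (auto simp: B_def Q_def)
    define \<eta> where "\<eta> = min (min 1 (m / 10)) (q / (5 * (Q + 1)))"
    have "\<eta> > 0" using m q0 B by (simp add: \<eta>_def)
    moreover have "\<eta> \<le> 1" "\<eta> \<le> m / 10" "\<eta> \<le> q / (5 * (Q + 1))"
      unfolding \<eta>_def by linarith+
    ultimately have \<eta>: "\<eta> > 0" "\<eta> \<le> 1" "\<eta> \<le> m / 10" "\<eta> \<le> q / (5 * (Q + 1))" by blast+
    have "\<eta> * Q \<le> q / (5 * (Q + 1)) * (Q + 1)"
      using B \<eta>(1,4) q0 by (intro mult_mono) auto
    also have "\<dots> = q / 5" using B by (simp add: nonzero_eq_divide_eq add_nonneg_eq_0_iff field_simps)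
    finally have \<eta>Q: "\<eta> * Q \<le> q / 5" .
    obtain \<delta>\<^sub>1 where d1: "\<delta>\<^sub>1 > 0" "\<And>s s' p. s \<in> \<sigma>\<^sub>1 \<Longrightarrow> s' \<in> \<sigma>\<^sub>1 \<Longrightarrow> p \<in> \<sigma>\<^sub>1 \<Longrightarrow>
        dist s p < \<delta>\<^sub>1 \<Longrightarrow> dist s' p < \<delta>\<^sub>1 \<Longrightarrow>
        norm (\<phi> s - \<phi> s' - L\<^sub>1 p (s - s')) \<le> \<eta> * norm (s - s')"
      using simplex_deriv_bounds(2)[OF tri \<sigma>(1) \<eta>(1)] unfolding L\<^sub>1_def by blast
    obtain \<delta>\<^sub>2 where d2: "\<delta>\<^sub>2 > 0" "\<And>s s' p. s \<in> \<sigma>\<^sub>2 \<Longrightarrow> s' \<in> \<sigma>\<^sub>2 \<Longrightarrow> p \<in> \<sigma>\<^sub>2 \<Longrightarrow>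
        dist s p < \<delta>\<^sub>2 \<Longrightarrow> dist s' p < \<delta>\<^sub>2 \<Longrightarrow>
        norm (\<phi> s - \<phi> s' - L\<^sub>2 p (s - s')) \<le> \<eta> * norm (s - s')"
      using simplex_deriv_bounds(2)[OF tri \<sigma>(2) \<eta>(1)] unfolding L\<^sub>2_def by blast
    define \<delta> where "\<delta> = min \<delta>\<^sub>1 \<delta>\<^sub>2"
    \<comment> \<open>The factor \<open>1 + 2 * C\<close> accounts for replacing a nearest point of \<open>F\<close> by \<open>p\<close>, and \<open>1 + \<Lambda> / m\<close> for
      the distance from \<open>s\<^sub>1\<close> to the foot of the perpendicular.\<close>
    define \<kappa> where "\<kappa> = (1 + 2 * C) * (1 + \<Lambda> / m)"
    have \<kappa>: "\<kappa> > 0" using C m by (simp add: \<kappa>_def add_pos_nonneg)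
    have \<delta>: "\<delta> > 0" "\<delta> / \<kappa> > 0" using d1 d2 \<kappa> by (auto simp: \<delta>_def)
    obtain r where r: "r > 0" "\<And>s\<^sub>1 s\<^sub>2. s\<^sub>1 \<in> \<sigma>\<^sub>1 \<Longrightarrow> s\<^sub>2 \<in> \<sigma>\<^sub>2 \<Longrightarrow> norm (\<phi> s\<^sub>1 - \<phi> s\<^sub>2) \<le> r \<Longrightarrow>
           \<exists>q\<in>F. dist s\<^sub>1 q + dist s\<^sub>1 s\<^sub>2 < \<delta> / \<kappa>"
      using contact[OF \<delta>(2)] by blast
    have "infdist (\<phi> s\<^sub>1) (skeleton K \<phi> M) \<le> 2 * norm (\<phi> s\<^sub>1 - \<phi> s\<^sub>2) / q"
      if s: "s\<^sub>1 \<in> \<sigma>\<^sub>1" "s\<^sub>2 \<in> \<sigma>\<^sub>2" and close: "norm (\<phi> s\<^sub>1 - \<phi> s\<^sub>2) \<le> r" for s\<^sub>1 s\<^sub>2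
    proof (cases "s\<^sub>1 \<in> F")
      case True
      then have "s\<^sub>1 \<notin> rel_interior \<sigma>\<^sub>1"
        using face_of_disjoint_rel_interior[OF F] by blast
      then have "\<phi> s\<^sub>1 \<in> skeleton K \<phi> M" using boundary_in_skeleton[OF tri \<sigma>(1) s(1)] by blast
      then show ?thesis using q0 by simp
    next
      case False
      obtain q\<^sub>0 where q\<^sub>0: "q\<^sub>0 \<in> F" "dist s\<^sub>1 q\<^sub>0 + dist s\<^sub>1 s\<^sub>2 < \<delta> / \<kappa>"
        using r(2)[OF s close] by blast
      obtain f where f: "f \<in> F" "\<And>a. a \<in> affine hull F \<Longrightarrow> norm (s\<^sub>1 - f) \<le> C * norm (s\<^sub>1 - a)"
        using C(2)[OF s(1)] by blast
      \<comment> \<open>The point \<open>f\<close> may lie on the boundary of \<open>F\<close>, but as \<open>s\<^sub>1 \<notin> F\<close> it can be moved into the relative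
        interior at the cost of at most doubling its distance to \<open>s\<^sub>1\<close>.\<close>
      have "f \<in> closure (rel_interior F)"
        using f(1) convex_closure_rel_interior[OF convF] closure_subset by blast
      moreover have "norm (s\<^sub>1 - f) > 0" using f(1) \<open>s\<^sub>1 \<notin> F\<close> by auto
      ultimately obtain p where p: "p \<in> rel_interior F" "dist p f < norm (s\<^sub>1 - f)"
        using closure_approachable by blast
      have pF: "p \<in> F" using p(1) rel_interior_subset by blast
      then have p\<sigma>: "p \<in> \<sigma>\<^sub>1" "p \<in> \<sigma>\<^sub>2" using F\<sigma> by auto
      have lin1: "linear (L\<^sub>1 p)"
        unfolding L\<^sub>1_def using simplex_deriv_has_derivative[OF tri \<sigma>(1) p\<sigma>(1)]
        by (rule has_derivative_linear)
      define w\<^sub>1 where "w\<^sub>1 = s\<^sub>1 - p"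
      define w\<^sub>2 where "w\<^sub>2 = s\<^sub>2 - p"
      have dirF: "dir_space F \<subseteq> dir_space \<sigma>\<^sub>1"
        using dir_space_mono F\<sigma>(1) .
      have w: "w\<^sub>1 \<in> dir_space \<sigma>\<^sub>1" "w\<^sub>2 \<in> dir_space \<sigma>\<^sub>2"
        unfolding w\<^sub>1_def w\<^sub>2_def using diff_in_dir_space s p\<sigma> by blast+
      obtain u\<^sub>1 where u1: "u\<^sub>1 \<in> dir_space F"
        and qv: "q * norm (L\<^sub>1 p (w\<^sub>1 - u\<^sub>1)) \<le> norm (L\<^sub>1 p w\<^sub>1 - L\<^sub>2 p w\<^sub>2)"
        and vw: "norm (L\<^sub>1 p (w\<^sub>1 - u\<^sub>1)) \<le> norm (L\<^sub>1 p w\<^sub>1)"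
        using tangent_distance_to_common_face[OF tri \<sigma> less_imp_le[OF \<theta>0[unfolded \<theta>_def]]
            p(1)[unfolded F_def] s]
        unfolding q_def \<theta>_def w\<^sub>1_def w\<^sub>2_def L\<^sub>1_def L\<^sub>2_def F_def by blast
      define v\<^sub>1 where "v\<^sub>1 = L\<^sub>1 p (w\<^sub>1 - u\<^sub>1)"
      note qv = qv[folded v\<^sub>1_def] and vw = vw[folded v\<^sub>1_def]
      have wu: "w\<^sub>1 - u\<^sub>1 \<in> dir_space \<sigma>\<^sub>1" using w u1 dirF by (auto intro: subspace_diff)
      \<comment> \<open>The foot of the perpendicular to the affine hull of the common face.\<close>
      define a where "a = p + u\<^sub>1"
      have a: "a \<in> affine hull F" unfolding a_def using affine_hull_eq_dir_space[OF pF] u1 by blast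
      have sa: "s\<^sub>1 - a = w\<^sub>1 - u\<^sub>1" by (simp add: a_def w\<^sub>1_def)
      have mv: "m * norm (w\<^sub>1 - u\<^sub>1) \<le> norm v\<^sub>1" unfolding v\<^sub>1_def using low1 p\<sigma> wu by blast
      have w1f: "norm w\<^sub>1 \<le> 2 * norm (s\<^sub>1 - f)"
        using p(2) dist_triangle[of s\<^sub>1 p f] by (simp add: w\<^sub>1_def dist_norm norm_minus_commute)
      also have "\<dots> \<le> 2 * (C * norm (w\<^sub>1 - u\<^sub>1))" using f(2)[OF a] sa by simp
      also have "\<dots> \<le> 2 * (C * (norm v\<^sub>1 / m))"
        using mv m C by (simp add: pos_le_divide_eq mult.commute)
      also have "\<dots> = B * norm v\<^sub>1" by (simp add: B_def)
      finally have W1: "norm w\<^sub>1 \<le> B * norm v\<^sub>1" .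
      have "norm (s\<^sub>1 - f) \<le> C * norm (s\<^sub>1 - q\<^sub>0)" using f(2) q\<^sub>0(1) by (simp add: hull_inc)
      with w1f have w1q: "norm w\<^sub>1 \<le> 2 * C * dist s\<^sub>1 q\<^sub>0" by (simp add: dist_norm)
      have small: "(norm w\<^sub>1 + dist s\<^sub>1 s\<^sub>2) * (1 + \<Lambda> / m) < \<delta>"
      proof -
        have "norm w\<^sub>1 + dist s\<^sub>1 s\<^sub>2 \<le> 2 * C * dist s\<^sub>1 q\<^sub>0 + dist s\<^sub>1 s\<^sub>2" using w1q by simp
        also have "\<dots> \<le> (1 + 2 * C) * (dist s\<^sub>1 q\<^sub>0 + dist s\<^sub>1 s\<^sub>2)"
          using C(1) by (simp add: algebra_simps)
        finally have "(norm w\<^sub>1 + dist s\<^sub>1 s\<^sub>2) * (1 + \<Lambda> / m)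
            \<le> (1 + 2 * C) * (dist s\<^sub>1 q\<^sub>0 + dist s\<^sub>1 s\<^sub>2) * (1 + \<Lambda> / m)"
          using m by (intro mult_right_mono) auto
        also have "\<dots> = \<kappa> * (dist s\<^sub>1 q\<^sub>0 + dist s\<^sub>1 s\<^sub>2)" by (simp add: \<kappa>_def)
        also have "\<dots> < \<delta>" using q\<^sub>0(2) \<kappa> by (simp add: pos_less_divide_eq mult.commute)
        finally show ?thesis .
      qed
      have "norm w\<^sub>1 + dist s\<^sub>1 s\<^sub>2 \<le> (norm w\<^sub>1 + dist s\<^sub>1 s\<^sub>2) * (1 + \<Lambda> / m)"
        using m by (simp add: algebra_simps)
      then have sum\<delta>: "norm w\<^sub>1 + dist s\<^sub>1 s\<^sub>2 < \<delta>" using small by linarith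
      have d: "dist s\<^sub>1 p = norm w\<^sub>1" "\<delta> \<le> \<delta>\<^sub>1" "\<delta> \<le> \<delta>\<^sub>2"
        by (simp_all add: w\<^sub>1_def dist_norm \<delta>_def)
      \<comment> \<open>The points \<open>s\<^sub>1\<close>, \<open>s\<^sub>2\<close> and, below, \<open>b\<close> are all in the range of the uniform linearization at \<open>p\<close>.\<close>
      have near1: "dist s\<^sub>1 p < \<delta>\<^sub>1"
        using sum\<delta> zero_le_dist[of s\<^sub>1 s\<^sub>2] d by linarith
      have near2: "dist s\<^sub>2 p < \<delta>\<^sub>2"
        using sum\<delta> dist_triangle3[of s\<^sub>2 p s\<^sub>1] d by linarith
      have err1: "norm (\<phi> s\<^sub>1 - \<phi> p - L\<^sub>1 p w\<^sub>1) \<le> \<eta> * norm w\<^sub>1"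
        unfolding w\<^sub>1_def using d1 near1 s p\<sigma> by simp
      have err2: "norm (\<phi> s\<^sub>2 - \<phi> p - L\<^sub>2 p w\<^sub>2) \<le> \<eta> * norm w\<^sub>2"
        unfolding w\<^sub>2_def using d2 near2 s p\<sigma> by simp
      define e where "e = norm (\<phi> s\<^sub>1 - \<phi> s\<^sub>2)"
      have V: "q * norm v\<^sub>1 \<le> e + \<eta> * norm w\<^sub>1 + \<eta> * norm w\<^sub>2"
      proof -
        have "norm (L\<^sub>1 p w\<^sub>1 - L\<^sub>2 p w\<^sub>2)
            \<le> e + norm (\<phi> s\<^sub>1 - \<phi> p - L\<^sub>1 p w\<^sub>1) + norm (\<phi> s\<^sub>2 - \<phi> p - L\<^sub>2 p w\<^sub>2)"
          unfolding e_def by norm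
        then show ?thesis using qv err1 err2 by linarith
      qed
      have W2: "m * norm w\<^sub>2 \<le> e + (\<Lambda> + \<eta>) * norm w\<^sub>1 + \<eta> * norm w\<^sub>2"
      proof -
        have "norm (L\<^sub>2 p w\<^sub>2) \<le> norm (L\<^sub>1 p w\<^sub>1) + e + norm (\<phi> s\<^sub>1 - \<phi> p - L\<^sub>1 p w\<^sub>1)
            + norm (\<phi> s\<^sub>2 - \<phi> p - L\<^sub>2 p w\<^sub>2)"
          unfolding e_def by norm
        moreover have "m * norm w\<^sub>2 \<le> norm (L\<^sub>2 p w\<^sub>2)" using low2 p\<sigma> w by blast
        moreover have "norm (L\<^sub>1 p w\<^sub>1) \<le> \<Lambda> * norm w\<^sub>1" using up1 p\<sigma> w by blast
        ultimately show ?thesis using err1 err2 by (simp add: distrib_right)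
      qed
      have est: "(1 + \<eta> / m) * norm v\<^sub>1 \<le> 2 * e / q"
        using perturbed_estimate[OF m(1) q0 B(1) m(2) norm_ge_zero _ norm_ge_zero norm_ge_zero
            \<eta>(1-3) \<eta>Q[unfolded Q_def] W1 W2 V]
        by (simp add: e_def)
      have "a \<notin> rel_interior \<sigma>\<^sub>1"
        using affine_hull_face_of_disjoint_rel_interior[OF conv(1) F] a by blast
      moreover have "a \<in> affine hull \<sigma>\<^sub>1" using a hull_mono[OF F\<sigma>(1)] by blast
      moreover have "closed \<sigma>\<^sub>1" using \<sigma>(3) closed_simplex by blast
      ultimately obtain b where b: "b \<in> \<sigma>\<^sub>1" "b \<notin> rel_interior \<sigma>\<^sub>1" "b \<in> closed_segment s\<^sub>1 a"
        using segment_meets_relative_boundary[of \<sigma>\<^sub>1 s\<^sub>1 a] s(1) by blast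
      obtain t where t: "0 \<le> t" "t \<le> 1" "b = (1 - t) *\<^sub>R s\<^sub>1 + t *\<^sub>R a"
        using b(3) by (auto simp: in_segment)
      have sb: "s\<^sub>1 - b = t *\<^sub>R (w\<^sub>1 - u\<^sub>1)"
        unfolding sa[symmetric] t(3) by (simp add: algebra_simps)
      have nsb: "norm (s\<^sub>1 - b) \<le> norm (w\<^sub>1 - u\<^sub>1)"
        unfolding sb using t by (simp add: mult_left_le_one_le)
      have "norm (w\<^sub>1 - u\<^sub>1) \<le> norm v\<^sub>1 / m" using mv m by (simp add: pos_le_divide_eq mult.commute)
      also have "\<dots> \<le> \<Lambda> * norm w\<^sub>1 / m"
        using vw up1[OF p\<sigma>(1) w(1)] m by (intro divide_right_mono) auto
      finally have "norm w\<^sub>1 + norm (w\<^sub>1 - u\<^sub>1) \<le> norm w\<^sub>1 * (1 + \<Lambda> / m)"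
        by (simp add: algebra_simps)
      also have "\<dots> \<le> (norm w\<^sub>1 + dist s\<^sub>1 s\<^sub>2) * (1 + \<Lambda> / m)"
        using m by (intro mult_right_mono) auto
      also note small
      finally have "dist b p < \<delta>"
        using nsb dist_triangle3[of b p s\<^sub>1] d(1) by (simp add: dist_norm)
      then have near_b: "dist b p < \<delta>\<^sub>1" using d(2) by linarith
      have "norm (\<phi> s\<^sub>1 - \<phi> b) \<le> norm (L\<^sub>1 p (s\<^sub>1 - b)) + norm (\<phi> s\<^sub>1 - \<phi> b - L\<^sub>1 p (s\<^sub>1 - b))"
        by norm
      also have "\<dots> \<le> norm v\<^sub>1 + \<eta> * (norm v\<^sub>1 / m)"
      proof (rule add_mono)
        have "L\<^sub>1 p (s\<^sub>1 - b) = t *\<^sub>R v\<^sub>1" unfolding sb v\<^sub>1_def using lin1 by (simp add: linear_scale)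
        then show "norm (L\<^sub>1 p (s\<^sub>1 - b)) \<le> norm v\<^sub>1" using t by (simp add: mult_left_le_one_le)
        have "norm (\<phi> s\<^sub>1 - \<phi> b - L\<^sub>1 p (s\<^sub>1 - b)) \<le> \<eta> * norm (s\<^sub>1 - b)"
          using d1(2)[OF s(1) b(1) p\<sigma>(1) near1 near_b] .
        also have "\<dots> \<le> \<eta> * (norm v\<^sub>1 / m)"
          using nsb \<open>norm (w\<^sub>1 - u\<^sub>1) \<le> norm v\<^sub>1 / m\<close> \<eta>(1) by (intro mult_left_mono) auto
        finally show "norm (\<phi> s\<^sub>1 - \<phi> b - L\<^sub>1 p (s\<^sub>1 - b)) \<le> \<eta> * (norm v\<^sub>1 / m)" .
      qed
      also have "\<dots> = (1 + \<eta> / m) * norm v\<^sub>1" by (simp add: algebra_simps)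
      also note est
      finally have "dist (\<phi> s\<^sub>1) (\<phi> b) \<le> 2 * e / q" by (simp add: dist_norm)
      moreover have "infdist (\<phi> s\<^sub>1) (skeleton K \<phi> M) \<le> dist (\<phi> s\<^sub>1) (\<phi> b)"
        using boundary_in_skeleton[OF tri \<sigma>(1) b(1,2)] by (rule infdist_le)
      ultimately show ?thesis by (simp add: e_def)
    qed
    then show ?thesis using r(1) unfolding q_def \<theta>_def by blast
  qed
qed

theorem proposition3p5:
  fixes K :: "'a::euclidean_space set set"
    and \<phi> :: "'a \<Rightarrow> 'b::euclidean_space"
    and M :: "'b set"
    and d :: nat
  assumes "admissible_triangulation d K \<phi> M"
  shows "\<exists>r\<^sub>0>0. \<forall>\<sigma>\<^sub>1\<in>K. \<forall>\<sigma>\<^sub>2\<in>K. int d simplex \<sigma>\<^sub>1 \<longrightarrow> int d simplex \<sigma>\<^sub>2 \<longrightarrow> \<sigma>\<^sub>1 \<noteq> \<sigma>\<^sub>2 \<longrightarrow>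
           (\<forall>x\<^sub>1 \<in> \<phi> ` \<sigma>\<^sub>1. \<forall>x\<^sub>2 \<in> \<phi> ` \<sigma>\<^sub>2. norm (x\<^sub>1 - x\<^sub>2) \<le> r\<^sub>0 \<longrightarrow>
              infdist x\<^sub>1 (skeleton K \<phi> M)
                \<le> 2 * norm (x\<^sub>1 - x\<^sub>2) / sin (strata_separation_angle d K \<phi> / 4) \<and>
              infdist x\<^sub>2 (skeleton K \<phi> M)
                \<le> 2 * norm (x\<^sub>1 - x\<^sub>2) / sin (strata_separation_angle d K \<phi> / 4))"
proof -
  define P where "P = {z \<in> K \<times> K. int d simplex fst z \<and> int d simplex snd z \<and> fst z \<noteq> snd z}"
  define near where "near z r \<longleftrightarrow> (\<forall>s\<in>fst z. \<forall>t\<in>snd z. norm (\<phi> s - \<phi> t) \<le> r \<longrightarrow>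
           infdist (\<phi> s) (skeleton K \<phi> M)
             \<le> 2 * norm (\<phi> s - \<phi> t) / sin (strata_separation_angle d K \<phi> / 4))" for z r
  have "finite K"
    using assms by (simp add: admissible_triangulation_def C2_triangulation_def simplicial_complex_def)
  then have fin: "finite P" by (simp add: P_def)
  have "\<exists>r>0. near z r" if "z \<in> P" for z
    using distance_to_skeleton_near_another_simplex[OF assms, of "fst z" "snd z"] that
    by (auto simp: P_def near_def mem_Times_iff)
  then obtain R where R: "\<And>z. z \<in> P \<Longrightarrow> R z > 0 \<and> near z (R z)"
    by metis
  define r\<^sub>0 where "r\<^sub>0 = Min (insert 1 (R ` P))"
  have r0: "r\<^sub>0 > 0" unfolding r\<^sub>0_def using fin R by (subst Min_gr_iff) auto
  have near: "near (\<sigma>, \<tau>) r\<^sub>0"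
    if "\<sigma> \<in> K" "\<tau> \<in> K" "int d simplex \<sigma>" "int d simplex \<tau>" "\<sigma> \<noteq> \<tau>" for \<sigma> \<tau>
  proof -
    have z: "(\<sigma>, \<tau>) \<in> P" using that by (simp add: P_def)
    then have "r\<^sub>0 \<le> R (\<sigma>, \<tau>)" unfolding r\<^sub>0_def using fin by (intro Min_le) auto
    then show ?thesis using R[OF z] unfolding near_def by force
  qed
  show ?thesis
  proof (intro exI[of _ r\<^sub>0] conjI r0 ballI impI)
    fix \<sigma>\<^sub>1 \<sigma>\<^sub>2 x\<^sub>1 x\<^sub>2
    assume \<sigma>: "\<sigma>\<^sub>1 \<in> K" "\<sigma>\<^sub>2 \<in> K" "int d simplex \<sigma>\<^sub>1" "int d simplex \<sigma>\<^sub>2" "\<sigma>\<^sub>1 \<noteq> \<sigma>\<^sub>2"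
      and "x\<^sub>1 \<in> \<phi> ` \<sigma>\<^sub>1" "x\<^sub>2 \<in> \<phi> ` \<sigma>\<^sub>2" and le: "norm (x\<^sub>1 - x\<^sub>2) \<le> r\<^sub>0"
    then obtain s\<^sub>1 s\<^sub>2 where s: "s\<^sub>1 \<in> \<sigma>\<^sub>1" "x\<^sub>1 = \<phi> s\<^sub>1" "s\<^sub>2 \<in> \<sigma>\<^sub>2" "x\<^sub>2 = \<phi> s\<^sub>2" by blast
    show "infdist x\<^sub>1 (skeleton K \<phi> M)
            \<le> 2 * norm (x\<^sub>1 - x\<^sub>2) / sin (strata_separation_angle d K \<phi> / 4)"
      using near[OF \<sigma>] s le by (simp add: near_def)
    show "infdist x\<^sub>2 (skeleton K \<phi> M)
            \<le> 2 * norm (x\<^sub>1 - x\<^sub>2) / sin (strata_separation_angle d K \<phi> / 4)"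
      using near[OF \<sigma>(2,1,4,3) \<sigma>(5)[symmetric]] s le
      by (simp add: near_def norm_minus_commute[of "\<phi> s\<^sub>1"])
  qed
qed

end
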